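(* (i) For $N=3$ ($r_1>r_2>r_3>0$), set $\Xi_3=r_2(r_1^3-r_2^3+r_3^3)+r_1r_3^2(r_2-r_3)$ and $\Delta_3=\Xi_3^2-4r_1r_2r_3^2(r_2-r_3)(r_1^3-r_2^3)$ (which is positive). For all sufficiently small $\delta>0$ the equation $\det\mathbf{A}_3(\omega,\delta)=0$ has two roots with positive real part, depending continuously on $\delta$, with $$\omega_{3,1}(\delta)=v_{\mathrm r}\sqrt{\frac{3\Xi_3-3\sqrt{\Delta_3}}{2(r_2-r_3)(r_1^3-r_2^3)r_3^2}}\,\delta^{1/2}-\mathrm{i}\frac{3(-\Xi_3+\sqrt{\Delta_3})+6r_2(r_1^3-r_2^3)}{4\tau(r_1^3-r_2^3)\sqrt{\Delta_3}}\,r_1^2v_{\mathrm r}\,\delta+O(\delta^{3/2}),$$ $$\omega_{3,2}(\delta)=v_{\mathrm r}\sqrt{\frac{3\Xi_3+3\sqrt{\Delta_3}}{2(r_2-r_3)(r_1^3-r_2^3)r_3^2}}\,\delta^{1/2}-\mathrm{i}\frac{3(\Xi_3+\sqrt{\Delta_3})-6r_2(r_1^3-r_2^3)}{4\tau(r_1^3-r_2^3)\sqrt{\Delta_3}}\,r_1^2v_{\mathrm r}\,\delta+O(\delta^{3/2}).$$ (ii) For $N=4$ ($r_1>r_2>r_3>r_4>0$), set $\Xi_4=r_2r_3(r_1^3-r_2^3+r_3^3-r_4^3)+r_1(r_2-r_3)(r_3^3-r_4^3)$, $P=(r_1^3-r_2^3)(r_3^3-r_4^3)(r_2-r_3)$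 and $\Delta_4=\Xi_4^2-4r_1r_2r_3P$ (which is positive). For all sufficiently small $\delta>0$ the equation $\det\mathbf{A}_4(\omega,\delta)=0$ has two roots with positive real part, depending continuously on $\delta$, with $$\omega_{4,1}(\delta)=v_{\mathrm r}\sqrt{\frac{3\Xi_4-3\sqrt{\Delta_4}}{2P}}\,\delta^{1/2}-\mathrm{i}\frac{3(-\Xi_4+\sqrt{\Delta_4})+6r_2r_3(r_1^3-r_2^3)}{4\tau(r_1^3-r_2^3)\sqrt{\Delta_4}}\,v_{\mathrm r}r_1^2\,\delta+O(\delta^{3/2}),$$ $$\omega_{4,2}(\delta)=v_{\mathrm r}\sqrt{\frac{3\Xi_4+3\sqrt{\Delta_4}}{2P}}\,\delta^{1/2}-\mathrm{i}\frac{3(\Xi_4+\sqrt{\Delta_4})-6r_2r_3(r_1^3-r_2^3)}{4\tau(r_1^3-r_2^3)\sqrt{\Delta_4}}\,v_{\mathrm r}r_1^2\,\delta+O(\delta^{3/2}).$$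
   Context: Concentric balls: radii $r_1>r_2>\dots>r_N>0$, $D_0=\{|x|>r_1\}$, $D_j=\{r_{j+1}<|x|\le r_j\}$ ($1\le j\le N-1$), $D_N=\{|x|\le r_N\}$. Odd layers are resonators with density/bulk modulus $\rho_{\mathrm r},\kappa_{\mathrm r}$; even layers (including $D_0$) have $\rho,\kappa$. $v_{\mathrm r}=\sqrt{\kappa_{\mathrm r}/\rho_{\mathrm r}}$, $v=\sqrt{\kappa/\rho}$ are fixed positive constants, $k_{\mathrm r}=\omega/v_{\mathrm r}$, $k=\omega/v$, $\delta=\rho_{\mathrm r}/\rho$, $\tau=v/v_{\mathrm r}$. Let $j(t)=j_0(t)=\sin t/t$ and $h(t)=h^{(1)}_0(t)=-\mathrm{i}e^{\mathrm{i}t}/t$, with $'$ denoting $d/dt$. The monopolar transmission matrix $\mathbf{A}_N(\omega,\delta)$ is the $2N\times2N$ block tridiagonal matrix with $2\times2$ diagonal blocks $M_i$ ($1\le i\le N$), superdiagonal blocks $R_i$ ($1\le i\le N-1$) and subdiagonal blocks $L_i$ ($2\le i\le N$), where for $i$ odd: $M_i=\begin{pmatrix}-h(kr_i)&j(k_{\mathrm r}r_i)\\-\delta h'(kr_i)&\tau j'(k_{\mathrm r}r_i)\end{pmatrix}$, $R_i=\begin{pmatrix}h(k_{\mathrm r}r_i)&0\\ \tau h'(k_{\mathrm r}r_i)&0\end{pmatrix}$, $L_i=\begin{pmatrix}0&-j(kr_i)\\0&-\delta j'(kr_i)\end{pmatrix}$; for $i$ even: $M_i=\begin{pmatrix}-h(k_{\mathrm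 r}r_i)&j(kr_i)\\-\tau h'(k_{\mathrm r}r_i)&\delta j'(kr_i)\end{pmatrix}$, $R_i=\begin{pmatrix}h(kr_i)&0\\ \delta h'(kr_i)&0\end{pmatrix}$, $L_i=\begin{pmatrix}0&-j(k_{\mathrm r}r_i)\\0&-\tau j'(k_{\mathrm r}r_i)\end{pmatrix}$. *)

theory Defs
  imports "HOL-Analysis.Derivative" "Jordan_Normal_Form.Determinant" "HOL-Library.Landau_Symbols"
begin

text \<open>Spherical Bessel j_0 and Hankel h_0^(1) (complex argument), and their derivatives d/dt.\<close>

definition sj :: "complex \<Rightarrow> complex" where
  "sj t = (if t = 0 then 1 else sin t / t)"

definition sh :: "complex \<Rightarrow> complex" where
  "sh t = - \<i> * exp (\<i> * t) / t"

definition sj' :: "complex \<Rightarrow> complex" where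
  "sj' t = deriv sj t"

definition sh' :: "complex \<Rightarrow> complex" where
  "sh' t = deriv sh t"

text \<open>Entry (a,b), a,b in {0,1}, of the 2x2 blocks M_i, R_i, L_i.  Parameters:
  radii r (r 1 > r 2 > ...), v, v_r, frequency w, density contrast d (= delta).
  For odd i the outer medium (wave number k, contrast d) sits at the "h" side; for even i it is swapped.\<close>

definition blkM :: "(nat \<Rightarrow> real) \<Rightarrow> real \<Rightarrow> real \<Rightarrow> complex \<Rightarrow> real \<Rightarrow> nat \<Rightarrow> nat \<Rightarrow> nat \<Rightarrow> complex" where
  "blkM r v vr w d i a b =
    (let k = w / complex_of_real v; kr = w / complex_of_real vr; \<tau> = complex_of_real (v / vr);
         \<delta> = complex_of_real d; ri = complex_of_real (r i) in
     if odd i then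
       (if a = 0 \<and> b = 0 then - sh (k * ri)
        else if a = 0 \<and> b = 1 then sj (kr * ri)
        else if a = 1 \<and> b = 0 then - \<delta> * sh' (k * ri)
        else \<tau> * sj' (kr * ri))
     else
       (if a = 0 \<and> b = 0 then - sh (kr * ri)
        else if a = 0 \<and> b = 1 then sj (k * ri)
        else if a = 1 \<and> b = 0 then - \<tau> * sh' (kr * ri)
        else \<delta> * sj' (k * ri)))"

definition blkR :: "(nat \<Rightarrow> real) \<Rightarrow> real \<Rightarrow> real \<Rightarrow> complex \<Rightarrow> real \<Rightarrow> nat \<Rightarrow> nat \<Rightarrow> nat \<Rightarrow> complex" where
  "blkR r v vr w d i a b =
    (let k = w / complex_of_real v; kr = w / complex_of_real vr; \<tau> = complex_of_real (v / vr);
         \<delta> = complex_of_real d; ri = complex_of_real (r i) in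
     if b = 1 then 0
     else if odd i then
       (if a = 0 then sh (kr * ri) else \<tau> * sh' (kr * ri))
     else
       (if a = 0 then sh (k * ri) else \<delta> * sh' (k * ri)))"

definition blkL :: "(nat \<Rightarrow> real) \<Rightarrow> real \<Rightarrow> real \<Rightarrow> complex \<Rightarrow> real \<Rightarrow> nat \<Rightarrow> nat \<Rightarrow> nat \<Rightarrow> complex" where
  "blkL r v vr w d i a b =
    (let k = w / complex_of_real v; kr = w / complex_of_real vr; \<tau> = complex_of_real (v / vr);
         \<delta> = complex_of_real d; ri = complex_of_real (r i) in
     if b = 0 then 0
     else if odd i then
       (if a = 0 then - sj (k * ri) else - \<delta> * sj' (k * ri))
     else
       (if a = 0 then - sj (kr * ri) else - \<tau> * sj' (kr * ri)))"

text \<open>The 2N x 2N monopolar transmission matrix A_N(w, d).  Row 2(i-1)+a lies in block row i,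
  column 2(l-1)+b in block column l (1-based blocks, 0-based matrix indices).\<close>

definition transA :: "nat \<Rightarrow> (nat \<Rightarrow> real) \<Rightarrow> real \<Rightarrow> real \<Rightarrow> complex \<Rightarrow> real \<Rightarrow> complex mat" where
  "transA N r v vr w d = mat (2 * N) (2 * N) (\<lambda>(p, q).
     let i = p div 2 + 1; a = p mod 2; l = q div 2 + 1; b = q mod 2 in
     if l = i then blkM r v vr w d i a b
     else if l = i + 1 then blkR r v vr w d i a b
     else if l + 1 = i then blkL r v vr w d i a b
     else 0)"

end

(*
Write \<omega> = v_r \<epsilon> \<zeta> with \<epsilon> = sqrt \<delta>. In every layer the pair (u, x^2 u'), the flux being divided by \<delta>
in the resonators, is carried from the inner to the outer radius by a 2x2 transfer matrix whose
entries are even entire functions of the wave number, hence agree with their values at \<epsilon> = 0 up to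
\<epsilon>^2 times a locally bounded and locally Lipschitz remainder. A solution started in the core and
continued outwards satisfies all transmission conditions except the radiation condition at r_1, which
reads Q(\<zeta>) + \<epsilon> R(\<zeta>) + \<epsilon>^2 g(\<zeta>, \<epsilon>) = 0, where Q is a quadratic polynomial in \<zeta>^2 with two
positive simple roots; the odd-order term comes from the factor i k r_1^2 - r_1 of the outgoing wave
only. Newton's map with frozen derivative is a contraction near each simple root \<zeta>_0 of Q, and its
fixed point is \<zeta>_0 - \<epsilon> R(\<zeta>_0) / Q'(\<zeta>_0) + O(\<epsilon>^2).
*)
theory Submission
  imports Defs "HOL-Analysis.Complex_Transcendental"
begin

section \<open>Even entire functions\<close>

text \<open>The entries of the transmission matrix built from \<open>sh\<close> have poles at
  frequency zero, so the matrix has no regular limit there. Field and flux as unknowns remove the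
  poles: a layer transfer involves only \<open>cos\<close>, \<open>sj\<close> and
  \<open>chi\<close>. The determinant is never expanded, since for the existence of roots it is
  enough that a nonzero outgoing solution yields a kernel vector. At leading order the field is
  constant across a resonator, whose flux drops by \<zeta>^2 times the integral of x^2 u; across a
  background layer the flux is constant and the field changes harmonically. Hence three and four
  layers differ in a single number: both arrive at r_3 with field 1 and flux - \<zeta>^2 E / 3,
  where E is r_3^3 or r_3^3 - r_4^3, because a background core produces flux only at order
  \<epsilon>^2. All that happens outside r_3 is done once, for a general E. At the real root
  \<zeta>_0 the term R is purely imaginary and Q' is real, so the term of order \<delta> in the
  frequency is purely imaginary.\<close>

definition chi :: "complex \<Rightarrow> complex" where
  "chi t = (if t = 0 then - 1 / 3 else (cos t - sj t) / t\<^sup>2)"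

lemma sj_has_field_derivative:
  assumes "t \<noteq> 0"
  shows "(sj has_field_derivative (cos t - sj t) / t) (at t)"
proof (rule has_field_derivative_transform_within)
  show "((\<lambda>t. sin t / t) has_field_derivative (cos t - sj t) / t) (at t)"
    using assms by (auto intro!: derivative_eq_intros simp: sj_def field_simps)
  show "0 < norm t" "t \<in> UNIV" using assms by simp_all
  show "sin y / y = sj y" if "dist y t < norm t" for y
    using that by (auto simp: sj_def dist_norm)
qed

text \<open>This explains \<open>chi\<close>: splitting the odd factor t off the derivative leaves
  an even function, which is a function of e^2 once the argument is scaled by e.\<close>

lemma sj'_eq:
  assumes "t \<noteq> 0"
  shows "sj' t = t * chi t"
  unfolding sj'_def DERIV_imp_deriv[OF sj_has_field_derivative[OF assms]] chi_def
  using assms by (simp add: power2_eq_square)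

lemma sh'_eq:
  assumes "t \<noteq> 0"
  shows "sh' t = exp (\<i> * t) * (t + \<i>) / t\<^sup>2"
proof -
  have "((\<lambda>t. - \<i> * exp (\<i> * t) / t) has_field_derivative exp (\<i> * t) * (t + \<i>) / t\<^sup>2) (at t)"
    using assms by (auto intro!: derivative_eq_intros simp: field_simps power2_eq_square)
  then show ?thesis
    unfolding sh'_def sh_def[abs_def] by (rule DERIV_imp_deriv)
qed

text \<open>The remainder after m terms is \<open>x ^ m\<close> times the series with shifted
  coefficients, which again converges everywhere. Its termwise derivative is such a series too,
  hence differentiable and in particular continuous.\<close>

lemma powser_entire_split:
  fixes c :: "nat \<Rightarrow> complex"
  assumes sums: "\<And>x. (\<lambda>n. c n * x ^ n) sums f x"
  obtains g g' where "\<And>x. f x = (\<Sum>i<m. c i * x ^ i) + x ^ m * g x"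
    and "\<And>x. (g has_field_derivative g' x) (at x)" and "continuous_on UNIV g'"
proof -
  define d where "d n = c (n + m)" for n
  have shift: "(\<lambda>n. x ^ m * (d n * x ^ n)) sums (f x - (\<Sum>i<m. c i * x ^ i))" for x
    using sums_split_initial_segment[OF sums[of x], of m]
    by (simp add: d_def power_add mult_ac)
  have sd: "summable (\<lambda>n. d n * x ^ n)" for x
  proof (cases "x = 0")
    case True
    then show ?thesis by (simp add: summable_0_powser)
  next
    case False
    then show ?thesis using shift[of x] by (metis sums_summable summable_mult_D power_not_zero)
  qed
  have sdd: "summable (\<lambda>n. diffs d n * x ^ n)" for x
    by (rule termdiff_converges_all) (rule sd)
  show ?thesis
  proof (rule that[of "\<lambda>x. \<Sum>n. d n * x ^ n" "\<lambda>x. \<Sum>n. diffs d n * x ^ n"])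
    show "f x = (\<Sum>i<m. c i * x ^ i) + x ^ m * (\<Sum>n. d n * x ^ n)" for x
      using sums_unique2[OF shift[of x] sums_mult[OF summable_sums[OF sd[of x]], of "x ^ m"]]
      by (simp add: algebra_simps)
    show "((\<lambda>x. \<Sum>n. d n * x ^ n) has_field_derivative (\<Sum>n. diffs d n * x ^ n)) (at x)" for x
      by (rule termdiffs_strong_converges_everywhere) (rule sd)
    have "isCont (\<lambda>x. \<Sum>n. diffs d n * x ^ n) x" for x
      by (rule DERIV_isCont) (rule termdiffs_strong_converges_everywhere[OF sdd])
    then show "continuous_on UNIV (\<lambda>x. \<Sum>n. diffs d n * x ^ n)"
      by (simp add: continuous_on_eq_continuous_at)
  qed
qed

text \<open>Continuity of the derivative is built in so that it is bounded on compact balls; this is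
  the source of all Lipschitz constants below.\<close>

definition entire :: "(complex \<Rightarrow> complex) \<Rightarrow> bool" where
  "entire f \<longleftrightarrow> (\<exists>f'. (\<forall>x. (f has_field_derivative f' x) (at x)) \<and> continuous_on UNIV f')"

lemma entireI:
  "(\<And>x. (f has_field_derivative f' x) (at x)) \<Longrightarrow> continuous_on UNIV f' \<Longrightarrow> entire f"
  unfolding entire_def by blast

lemma entire_diff:
  assumes "entire f" "entire g"
  shows "entire (\<lambda>x. f x - g x)"
proof -
  obtain f' g' where "\<And>x. (f has_field_derivative f' x) (at x)" "continuous_on UNIV f'"
    "\<And>x. (g has_field_derivative g' x) (at x)" "continuous_on UNIV g'"
    using assms unfolding entire_def by blast
  then show ?thesis
    by (intro entireI[of _ "\<lambda>x. f' x - g' x"] DERIV_diff continuous_on_diff)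
qed

lemma entire_offset:
  assumes "entire f"
  shows "entire (\<lambda>x. c + x\<^sup>2 * f x)"
proof -
  obtain f' where *: "\<And>x. (f has_field_derivative f' x) (at x)" "continuous_on UNIV f'"
    using assms unfolding entire_def by blast
  have "continuous_on UNIV f"
    using *(1) by (meson DERIV_isCont continuous_at_imp_continuous_on)
  then show ?thesis
    by (intro entireI[of _ "\<lambda>x. 2 * x * f x + x\<^sup>2 * f' x"])
      (auto intro!: derivative_eq_intros *(1) continuous_intros *(2) simp: power2_eq_square algebra_simps)
qed

text \<open>The orders 4 and 5 are forced by \<open>chi\<close>: \<open>sj\<close> loses one power
  of t, the quotient by t^2 two more, and a factor t^2 must still be left in front of the
  remainder.\<close>

lemma trig_even_expansions:
  obtains C S X where "entire C" "entire S" "entire X"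
    "\<And>t. cos t = 1 + t\<^sup>2 * C t" "\<And>t. sj t = 1 + t\<^sup>2 * S t" "\<And>t. chi t = - 1 / 3 + t\<^sup>2 * X t"
proof -
  have c: "(\<lambda>n. of_real (cos_coeff n) * x ^ n) sums cos x"
    and s: "(\<lambda>n. of_real (sin_coeff n) * x ^ n) sums sin x" for x :: complex
    using cos_converges[of x] sin_converges[of x] by (simp_all add: scaleR_conv_of_real)
  obtain a a' where a: "\<And>x::complex. cos x = (\<Sum>i<4. of_real (cos_coeff i) * x ^ i) + x ^ 4 * a x"
    "\<And>x. (a has_field_derivative a' x) (at x)" "continuous_on UNIV a'"
    using powser_entire_split[OF c, of 4] by blast
  obtain b b' where b: "\<And>x::complex. sin x = (\<Sum>i<5. of_real (sin_coeff i) * x ^ i) + x ^ 5 * b x"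
    "\<And>x. (b has_field_derivative b' x) (at x)" "continuous_on UNIV b'"
    using powser_entire_split[OF s, of 5] by blast
  have cos: "cos x = 1 - x\<^sup>2 / 2 + x ^ 4 * a x" for x
  proof -
    have "{..<4} = {0, 1, 2, 3 :: nat}" by auto
    then show ?thesis unfolding a(1) by (simp add: cos_coeff_def fact_numeral)
  qed
  have sin: "sin x = x - x ^ 3 / 6 + x ^ 5 * b x" for x
  proof -
    have "{..<5} = {0, 1, 2, 3, 4 :: nat}" by auto
    then show ?thesis unfolding b(1) by (simp add: sin_coeff_def fact_numeral)
  qed
  have sj: "sj x = 1 - x\<^sup>2 / 6 + x ^ 4 * b x" for x
    by (cases "x = 0") (simp_all add: sj_def sin field_simps eval_nat_numeral)
  have ab: "entire a" "entire b" using a(2,3) b(2,3) by (auto intro: entireI)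
  show ?thesis
  proof (rule that[of "\<lambda>x. - 1 / 2 + x\<^sup>2 * a x" "\<lambda>x. - 1 / 6 + x\<^sup>2 * b x" "\<lambda>x. a x - b x"])
    show "chi t = - 1 / 3 + t\<^sup>2 * (a t - b t)" for t
      by (simp add: chi_def cos sj field_simps eval_nat_numeral)
    show "entire (\<lambda>x. - 1 / 2 + x\<^sup>2 * a x)" "entire (\<lambda>x. - 1 / 6 + x\<^sup>2 * b x)"
      "entire (\<lambda>x. a x - b x)"
      by (intro entire_offset entire_diff ab)+
  qed (simp_all add: cos sj algebra_simps eval_nat_numeral)
qed

section \<open>Families Lipschitz in the frequency\<close>

text \<open>Bounds are local in z but uniform in e, so that the radius of contraction and the error
  constant do not depend on e. Continuity in e at fixed z is what later makes the roots continuous.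
  The value e = 0 is excluded because fluxes get divided by e^2.\<close>

definition lip_family :: "(complex \<Rightarrow> real \<Rightarrow> complex) \<Rightarrow> bool" where
  "lip_family g \<longleftrightarrow>
    (\<forall>R. \<exists>M. \<forall>e\<in>{0<..<1}. \<forall>z\<in>cball 0 R. \<forall>w\<in>cball 0 R.
       norm (g z e) \<le> M \<and> norm (g z e - g w e) \<le> M * norm (z - w)) \<and>
    (\<forall>z. continuous_on {0<..<1} (g z))"

lemma lip_familyD:
  assumes "lip_family g"
  obtains M where "0 < M"
    "\<And>z e. 0 < e \<Longrightarrow> e < 1 \<Longrightarrow> norm z \<le> R \<Longrightarrow> norm (g z e) \<le> M"
    "\<And>z w e. 0 < e \<Longrightarrow> e < 1 \<Longrightarrow> norm z \<le> R \<Longrightarrow> norm w \<le> R \<Longrightarrow>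
       norm (g z e - g w e) \<le> M * norm (z - w)"
proof -
  obtain M where M: "\<And>z w e. e \<in> {0<..<1} \<Longrightarrow> z \<in> cball 0 R \<Longrightarrow> w \<in> cball 0 R \<Longrightarrow>
      norm (g z e) \<le> M \<and> norm (g z e - g w e) \<le> M * norm (z - w)"
    using assms unfolding lip_family_def by blast
  show ?thesis
  proof (rule that[of "max M 1"])
    show "norm (g z e) \<le> max M 1" if "0 < e" "e < 1" "norm z \<le> R" for z e
      using M[of e z z] that by auto
    show "norm (g z e - g w e) \<le> max M 1 * norm (z - w)"
      if "0 < e" "e < 1" "norm z \<le> R" "norm w \<le> R" for z w e
    proof -
      have "norm (g z e - g w e) \<le> M * norm (z - w)"
        using M[of e z w] that by auto
      also have "\<dots> \<le> max M 1 * norm (z - w)"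
        by (intro mult_right_mono) auto
      finally show ?thesis .
    qed
  qed auto
qed

lemma lip_familyI:
  assumes "\<And>R. \<exists>M. \<forall>e z w. 0 < e \<longrightarrow> e < 1 \<longrightarrow> norm z \<le> R \<longrightarrow> norm w \<le> R \<longrightarrow>
      norm (g z e) \<le> M \<and> norm (g z e - g w e) \<le> M * norm (z - w)"
    and "\<And>z. continuous_on {0<..<1} (g z)"
  shows "lip_family g"
  unfolding lip_family_def
proof (intro conjI allI)
  show "\<exists>M. \<forall>e\<in>{0<..<1}. \<forall>z\<in>cball 0 R. \<forall>w\<in>cball 0 R.
       norm (g z e) \<le> M \<and> norm (g z e - g w e) \<le> M * norm (z - w)" for R
  proof -
    obtain M where "\<forall>e z w. 0 < e \<longrightarrow> e < 1 \<longrightarrow> norm z \<le> R \<longrightarrow> norm w \<le> R \<longrightarrow>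
        norm (g z e) \<le> M \<and> norm (g z e - g w e) \<le> M * norm (z - w)"
      using assms(1)[of R] by blast
    then show ?thesis by (intro exI[of _ M]) auto
  qed
qed (rule assms(2))

lemma lip_family_const [intro]: "lip_family (\<lambda>z e. c)"
  by (rule lip_familyI) (auto intro!: exI[of _ "norm c"])

lemma lip_family_var [intro]: "lip_family (\<lambda>z e. z)"
proof (rule lip_familyI)
  show "\<exists>M. \<forall>e z w. 0 < e \<longrightarrow> e < 1 \<longrightarrow> norm z \<le> R \<longrightarrow> norm w \<le> R \<longrightarrow>
      norm z \<le> M \<and> norm (z - w) \<le> M * norm (z - w)" for R
    by (intro exI[of _ "max R 1"]) (auto intro: mult_right_mono[of 1 "max R 1", simplified])
qed auto

lemma lip_family_eps [intro]: "lip_family (\<lambda>z e. complex_of_real e)"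
  by (rule lip_familyI) (auto intro!: exI[of _ 1] continuous_intros)

lemma lip_family_add [intro]:
  assumes "lip_family f" "lip_family g"
  shows "lip_family (\<lambda>z e. f z e + g z e)"
proof (rule lip_familyI)
  fix R :: real
  obtain M where M: "0 < M"
    "\<And>z e. 0 < e \<Longrightarrow> e < 1 \<Longrightarrow> norm z \<le> R \<Longrightarrow> norm (f z e) \<le> M"
    "\<And>z w e. 0 < e \<Longrightarrow> e < 1 \<Longrightarrow> norm z \<le> R \<Longrightarrow> norm w \<le> R \<Longrightarrow>
       norm (f z e - f w e) \<le> M * norm (z - w)"
    using lip_familyD[OF assms(1)] by metis
  obtain K where K: "0 < K"
    "\<And>z e. 0 < e \<Longrightarrow> e < 1 \<Longrightarrow> norm z \<le> R \<Longrightarrow> norm (g z e) \<le> K"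
    "\<And>z w e. 0 < e \<Longrightarrow> e < 1 \<Longrightarrow> norm z \<le> R \<Longrightarrow> norm w \<le> R \<Longrightarrow>
       norm (g z e - g w e) \<le> K * norm (z - w)"
    using lip_familyD[OF assms(2)] by metis
  have "norm (f z e + g z e) \<le> M + K" if "0 < e" "e < 1" "norm z \<le> R" for z e
    using M(2)[OF that] K(2)[OF that] norm_triangle_ineq[of "f z e" "g z e"] by linarith
  moreover have "norm (f z e + g z e - (f w e + g w e)) \<le> (M + K) * norm (z - w)"
    if "0 < e" "e < 1" "norm z \<le> R" "norm w \<le> R" for z w e
    using M(3)[OF that] K(3)[OF that] norm_triangle_ineq[of "f z e - f w e" "g z e - g w e"]
    by (simp add: algebra_simps)
  ultimately show "\<exists>M. \<forall>e z w. 0 < e \<longrightarrow> e < 1 \<longrightarrow> norm z \<le> R \<longrightarrow> norm w \<le> R \<longrightarrow>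
      norm (f z e + g z e) \<le> M \<and> norm (f z e + g z e - (f w e + g w e)) \<le> M * norm (z - w)"
    by blast
qed (use assms in \<open>auto simp: lip_family_def intro: continuous_on_add\<close>)

lemma lip_family_mult [intro]:
  assumes "lip_family f" "lip_family g"
  shows "lip_family (\<lambda>z e. f z e * g z e)"
proof (rule lip_familyI)
  fix R :: real
  obtain M where M: "0 < M"
    "\<And>z e. 0 < e \<Longrightarrow> e < 1 \<Longrightarrow> norm z \<le> R \<Longrightarrow> norm (f z e) \<le> M"
    "\<And>z w e. 0 < e \<Longrightarrow> e < 1 \<Longrightarrow> norm z \<le> R \<Longrightarrow> norm w \<le> R \<Longrightarrow>
       norm (f z e - f w e) \<le> M * norm (z - w)"
    using lip_familyD[OF assms(1)] by metis
  obtain K where K: "0 < K"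
    "\<And>z e. 0 < e \<Longrightarrow> e < 1 \<Longrightarrow> norm z \<le> R \<Longrightarrow> norm (g z e) \<le> K"
    "\<And>z w e. 0 < e \<Longrightarrow> e < 1 \<Longrightarrow> norm z \<le> R \<Longrightarrow> norm w \<le> R \<Longrightarrow>
       norm (g z e - g w e) \<le> K * norm (z - w)"
    using lip_familyD[OF assms(2)] by metis
  \<comment> \<open>One constant has to serve as bound and as Lipschitz constant; the factor 2 comes
    from the product rule in the second estimate.\<close>
  have "norm (f z e * g z e) \<le> 2 * M * K" if "0 < e" "e < 1" "norm z \<le> R" for z e
  proof -
    have "norm (f z e * g z e) \<le> M * K"
      using M K that by (auto simp: norm_mult intro!: mult_mono less_imp_le[OF M(1)])
    also have "\<dots> \<le> 2 * M * K" using M(1) K(1) by simp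
    finally show ?thesis .
  qed
  moreover have "norm (f z e * g z e - f w e * g w e) \<le> 2 * M * K * norm (z - w)"
    if "0 < e" "e < 1" "norm z \<le> R" "norm w \<le> R" for z w e
  proof -
    have "norm (f z e * g z e - f w e * g w e)
        = norm (f z e * (g z e - g w e) + (f z e - f w e) * g w e)"
      by (simp add: algebra_simps)
    also have "\<dots> \<le> norm (f z e) * norm (g z e - g w e) + norm (f z e - f w e) * norm (g w e)"
      by (metis norm_mult norm_triangle_ineq)
    also have "\<dots> \<le> M * (K * norm (z - w)) + (M * norm (z - w)) * K"
      using M K that by (intro add_mono mult_mono) (auto intro!: mult_nonneg_nonneg less_imp_le[OF M(1)])
    finally show ?thesis by (simp add: algebra_simps)
  qed
  ultimately show "\<exists>M. \<forall>e z w. 0 < e \<longrightarrow> e < 1 \<longrightarrow> norm z \<le> R \<longrightarrow> norm w \<le> R \<longrightarrow>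
      norm (f z e * g z e) \<le> M \<and> norm (f z e * g z e - f w e * g w e) \<le> M * norm (z - w)"
    by blast
qed (use assms in \<open>auto simp: lip_family_def intro: continuous_on_mult\<close>)

lemma lip_family_power [intro]: "lip_family f \<Longrightarrow> lip_family (\<lambda>z e. f z e ^ n)"
  by (induction n) auto

lemma lip_family_entire:
  assumes "entire f"
  shows "lip_family (\<lambda>z e. f (of_real e * z * c))"
proof -
  obtain f' where f': "\<And>x. (f has_field_derivative f' x) (at x)" "continuous_on UNIV f'"
    using assms unfolding entire_def by blast
  have cont: "continuous_on A f" for A
    using f'(1) by (meson DERIV_isCont continuous_at_imp_continuous_on)
  show ?thesis
  proof (rule lip_familyI)
    fix R :: real
    \<comment> \<open>As e < 1, this ball contains the arguments for all e at once.\<close>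
    define S where "S = cball (0::complex) (R * norm c)"
    have "bounded (f ` S)" "bounded (f' ` S)"
      unfolding S_def
      by (intro compact_imp_bounded compact_continuous_image cont continuous_on_subset[OF f'(2)]; simp)+
    then obtain A B where A: "\<And>x. x \<in> S \<Longrightarrow> norm (f x) \<le> A" and B: "\<And>x. x \<in> S \<Longrightarrow> norm (f' x) \<le> B"
      unfolding bounded_iff by blast
    define M where "M = max A (max B 0 * norm c)"
    have in_S: "of_real e * z * c \<in> S" if "0 < e" "e < 1" "norm z \<le> R" for e z
    proof -
      have "e * norm z \<le> 1 * R" using that by (intro mult_mono) auto
      then show ?thesis using that by (auto simp: S_def norm_mult intro!: mult_right_mono)
    qed
    have "norm (f (of_real e * z * c)) \<le> M" if "0 < e" "e < 1" "norm z \<le> R" for e z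
      using A[OF in_S[OF that]] by (auto simp: M_def)
    moreover have "norm (f (of_real e * z * c) - f (of_real e * w * c)) \<le> M * norm (z - w)"
      if "0 < e" "e < 1" "norm z \<le> R" "norm w \<le> R" for e z w
    proof -
      have "norm (f (of_real e * z * c) - f (of_real e * w * c))
          \<le> max B 0 * norm (of_real e * z * c - of_real e * w * c)"
      proof (rule field_differentiable_bound[of S f f'])
        show "norm (f' x) \<le> max B 0" if "x \<in> S" for x using B[OF that] by simp
      qed (use in_S that in \<open>auto simp: S_def intro: DERIV_subset[OF f'(1)]\<close>)
      also have "of_real e * z * c - of_real e * w * c = of_real e * (z - w) * c"
        by (simp add: algebra_simps)
      also have "max B 0 * norm (of_real e * (z - w) * c) = e * (max B 0 * norm c * norm (z - w))"
        using that by (simp add: norm_mult)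
      also have "\<dots> \<le> 1 * (max B 0 * norm c * norm (z - w))"
        using that by (intro mult_right_mono) auto
      also have "\<dots> \<le> M * norm (z - w)"
        unfolding M_def by (auto intro: mult_right_mono)
      finally show ?thesis .
    qed
    ultimately show "\<exists>M. \<forall>e z w. 0 < e \<longrightarrow> e < 1 \<longrightarrow> norm z \<le> R \<longrightarrow> norm w \<le> R \<longrightarrow>
        norm (f (of_real e * z * c)) \<le> M \<and>
        norm (f (of_real e * z * c) - f (of_real e * w * c)) \<le> M * norm (z - w)"
      by blast
  qed (intro continuous_on_compose2[OF cont[of UNIV]] continuous_intros; simp)
qed

section \<open>Expansions with a remainder of order e^2\<close>

definition expands :: "(complex \<Rightarrow> real \<Rightarrow> complex) \<Rightarrow> (complex \<Rightarrow> complex) \<Rightarrow> bool" where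
  "expands f f0 \<longleftrightarrow> lip_family (\<lambda>z e. f0 z) \<and>
     (\<exists>g. lip_family g \<and> (\<forall>z e. 0 < e \<longrightarrow> e < 1 \<longrightarrow> f z e = f0 z + (of_real e)\<^sup>2 * g z e))"

lemma expandsI:
  assumes "lip_family (\<lambda>z e. f0 z)" "lip_family g"
    "\<And>z e. 0 < e \<Longrightarrow> e < 1 \<Longrightarrow> f z e = f0 z + (of_real e)\<^sup>2 * g z e"
  shows "expands f f0"
  using assms unfolding expands_def by blast

lemma expandsE:
  assumes "expands f f0"
  obtains g where "lip_family (\<lambda>z e. f0 z)" "lip_family g"
    "\<And>z e. 0 < e \<Longrightarrow> e < 1 \<Longrightarrow> f z e = f0 z + (of_real e)\<^sup>2 * g z e"
  using assms unfolding expands_def by blast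

lemma expands_lip: "lip_family (\<lambda>z e. f z) \<Longrightarrow> expands (\<lambda>z e. f z) f"
  by (rule expandsI[where g = "\<lambda>z e. 0"]) auto

lemma expands_const: "expands (\<lambda>z e. c) (\<lambda>z. c)"
  by (rule expands_lip) auto

lemma expands_var: "expands (\<lambda>z e. z) (\<lambda>z. z)"
  by (rule expands_lip) auto

lemma expands_eps2: "expands (\<lambda>z e. (of_real e)\<^sup>2) (\<lambda>z. 0)"
  by (rule expandsI[where g = "\<lambda>z e. 1"]) auto

lemma expands_add:
  assumes "expands f f0" "expands g g0"
  shows "expands (\<lambda>z e. f z e + g z e) (\<lambda>z. f0 z + g0 z)"
proof -
  obtain h k where "lip_family (\<lambda>z e. f0 z)" "lip_family h"
    "\<And>z e. 0 < e \<Longrightarrow> e < 1 \<Longrightarrow> f z e = f0 z + (of_real e)\<^sup>2 * h z e"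
    "lip_family (\<lambda>z e. g0 z)" "lip_family k"
    "\<And>z e. 0 < e \<Longrightarrow> e < 1 \<Longrightarrow> g z e = g0 z + (of_real e)\<^sup>2 * k z e"
    using assms by (elim expandsE) blast
  then show ?thesis
    by (intro expandsI[where g = "\<lambda>z e. h z e + k z e"]) (auto simp: algebra_simps)
qed

lemma expands_mult:
  assumes "expands f f0" "expands g g0"
  shows "expands (\<lambda>z e. f z e * g z e) (\<lambda>z. f0 z * g0 z)"
proof -
  obtain h k where "lip_family (\<lambda>z e. f0 z)" "lip_family h"
    "\<And>z e. 0 < e \<Longrightarrow> e < 1 \<Longrightarrow> f z e = f0 z + (of_real e)\<^sup>2 * h z e"
    "lip_family (\<lambda>z e. g0 z)" "lip_family k"
    "\<And>z e. 0 < e \<Longrightarrow> e < 1 \<Longrightarrow> g z e = g0 z + (of_real e)\<^sup>2 * k z e"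
    using assms by (elim expandsE) blast
  then show ?thesis
    by (intro expandsI[where g = "\<lambda>z e. f0 z * k z e + h z e * g0 z + (of_real e)\<^sup>2 * (h z e * k z e)"]
        lip_family_add lip_family_mult lip_family_power lip_family_eps)
      (auto simp: algebra_simps power2_eq_square)
qed

text \<open>The square of t = e z c supplies the factor e^2; the rest of it,
  \<open>z * z * (c * c)\<close>, joins the remainder.\<close>

lemma expands_even:
  assumes "\<And>t. f t = c0 + t\<^sup>2 * F t" "entire F"
  shows "expands (\<lambda>z e. f (of_real e * z * c)) (\<lambda>z. c0)"
proof (rule expandsI[where g = "\<lambda>z e. (z * z * (c * c)) * F (of_real e * z * c)"])
  show "lip_family (\<lambda>z e. (z * z * (c * c)) * F (of_real e * z * c))"
    by (intro lip_family_mult lip_family_var lip_family_const lip_family_entire assms(2))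
  show "f (of_real e * z * c) = c0 + (of_real e)\<^sup>2 * (z * z * (c * c) * F (of_real e * z * c))" for z e
    by (simp only: assms(1)) (simp add: power2_eq_square mult_ac)
qed (rule lip_family_const)

lemma expands_cong:
  assumes "expands f f0" "\<And>z e. 0 < e \<Longrightarrow> e < 1 \<Longrightarrow> g z e = f z e" "\<And>z. g0 z = f0 z"
  shows "expands g g0"
proof -
  have "g0 = f0" using assms(3) by auto
  with assms(1,2) show ?thesis unfolding expands_def by simp
qed

lemma expands_trig:
  "expands (\<lambda>z e. cos (of_real e * z * c)) (\<lambda>z. 1)"
  "expands (\<lambda>z e. sj (of_real e * z * c)) (\<lambda>z. 1)"
  "expands (\<lambda>z e. chi (of_real e * z * c)) (\<lambda>z. - 1 / 3)"
proof -
  obtain C S X where *: "entire C" "entire S" "entire X"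
    "\<And>t. cos t = 1 + t\<^sup>2 * C t" "\<And>t. sj t = 1 + t\<^sup>2 * S t" "\<And>t. chi t = - 1 / 3 + t\<^sup>2 * X t"
    using trig_even_expansions by blast
  show "expands (\<lambda>z e. cos (of_real e * z * c)) (\<lambda>z. 1)"
    "expands (\<lambda>z e. sj (of_real e * z * c)) (\<lambda>z. 1)"
    "expands (\<lambda>z e. chi (of_real e * z * c)) (\<lambda>z. - 1 / 3)"
    by (rule expands_even[OF *(4) *(1)] expands_even[OF *(5) *(2)] expands_even[OF *(6) *(3)])+
qed

section \<open>Perturbation of a simple root\<close>

text \<open>Only \<open>Q\<close> is differentiated; the other two terms have a Lipschitz constant
  of order e and so cannot destroy the contraction. The value \<open>z1\<close> balances the terms
  of order e in \<open>G\<close> at z0 + e z1.\<close>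

lemma perturbed_simple_root:
  fixes Q Q' R :: "complex \<Rightarrow> complex" and z0 :: complex
  assumes dQ: "\<And>z. (Q has_field_derivative Q' z) (at z)"
    and lQ': "lip_family (\<lambda>z e. Q' z)" and lR: "lip_family (\<lambda>z e. R z)" and lg: "lip_family g"
    and root: "Q z0 = 0" and simple: "Q' z0 \<noteq> 0"
  defines "z1 \<equiv> - R z0 / Q' z0"
  defines "G \<equiv> \<lambda>z e. Q z + of_real e * R z + (of_real e)\<^sup>2 * g z e"
  obtains e0 C Z where "0 < e0" "e0 \<le> 1" "0 \<le> C" "continuous_on {0<..<e0} Z"
    "\<And>e. 0 < e \<Longrightarrow> e < e0 \<Longrightarrow> G (Z e) e = 0"
    "\<And>e. 0 < e \<Longrightarrow> e < e0 \<Longrightarrow> norm (Z e - (z0 + of_real e * z1)) \<le> C * e\<^sup>2"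
proof -
  define D where "D = Q' z0"
  define S where "S = norm z0 + 1"
  have D0: "0 < norm D" using simple by (simp add: D_def)
  \<comment> \<open>These families do not depend on e; \<open>dense\<close> supplies some e between
    0 and 1 at which the bounds can be read off.\<close>
  obtain K where K: "0 < K"
    "\<And>z w. norm z \<le> S \<Longrightarrow> norm w \<le> S \<Longrightarrow> norm (Q' z - Q' w) \<le> K * norm (z - w)"
    using lip_familyD[OF lQ', of S] by (metis less_numeral_extra(1) dense)
  obtain A where A: "0 < A" "\<And>z. norm z \<le> S \<Longrightarrow> norm (R z) \<le> A"
    "\<And>z w. norm z \<le> S \<Longrightarrow> norm w \<le> S \<Longrightarrow> norm (R z - R w) \<le> A * norm (z - w)"
    using lip_familyD[OF lR, of S] by (metis less_numeral_extra(1) dense)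
  obtain B where B: "0 < B" "\<And>z e. 0 < e \<Longrightarrow> e < 1 \<Longrightarrow> norm z \<le> S \<Longrightarrow> norm (g z e) \<le> B"
    "\<And>z w e. 0 < e \<Longrightarrow> e < 1 \<Longrightarrow> norm z \<le> S \<Longrightarrow> norm w \<le> S \<Longrightarrow>
       norm (g z e - g w e) \<le> B * norm (z - w)"
    using lip_familyD[OF lg, of S] by metis
  define M where "M = A + B"
  have M0: "0 < M" using A(1) B(1) by (simp add: M_def)
  \<comment> \<open>Used with c = |z - w| for the contraction and with c = 1 for the size of
    \<open>G\<close> at z0.\<close>
  have small: "norm (of_real e * x + (of_real e)\<^sup>2 * y) \<le> e * M * c"
    if "0 < e" "e < 1" "norm x \<le> A * c" "norm y \<le> B * c" "0 \<le> c" for e c :: real and x y :: complex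
  proof -
    have "norm (of_real e * x + (of_real e)\<^sup>2 * y) \<le> e * norm x + e\<^sup>2 * norm y"
      using norm_triangle_ineq[of "of_real e * x" "(of_real e)\<^sup>2 * y"] that
      by (simp add: norm_mult norm_power)
    also have "\<dots> \<le> e * (A * c) + e * (B * c)"
      using that B(1) by (intro add_mono mult_mono) (auto simp: power2_eq_square)
    finally show ?thesis by (simp add: M_def algebra_simps)
  qed
  \<comment> \<open>Mean value bound for \<open>Q z - D * z\<close>. The radius d stays free: \<rho>
    serves the contraction, while e |z1| makes the linearisation error quadratic in e.\<close>
  have linear: "norm (Q z - Q w - D * (z - w)) \<le> K * d * norm (z - w)"
    if "z \<in> cball z0 d" "w \<in> cball z0 d" "d \<le> 1" for z w d
  proof -
    have "norm ((Q z - D * z) - (Q w - D * w)) \<le> K * d * norm (z - w)"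
    proof (rule field_differentiable_bound[of "cball z0 d" _ "\<lambda>z. Q' z - D"])
      show "norm (Q' x - D) \<le> K * d" if x: "x \<in> cball z0 d" for x
      proof -
        have n: "norm (x - z0) \<le> d" using x by (simp add: dist_norm norm_minus_commute)
        have "norm x \<le> norm z0 + norm (x - z0)" by (metis add.commute diff_add_cancel norm_triangle_ineq)
        then have "norm (Q' x - D) \<le> K * norm (x - z0)"
          unfolding D_def using K(2)[of x z0] n \<open>d \<le> 1\<close> by (simp add: S_def)
        also have "\<dots> \<le> K * d" using K(1) n by simp
        finally show ?thesis .
      qed
    qed (use that in \<open>auto intro!: derivative_eq_intros DERIV_subset[OF dQ]\<close>)
    then show ?thesis by (simp add: algebra_simps)
  qed
  \<comment> \<open>On this ball Q' differs from D by at most |D| / 4, which uses up half of the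
    contraction factor 1/2. The cap 1 keeps the ball inside norm at most \<open>S\<close>.\<close>
  define \<rho> where "\<rho> = min 1 (norm D / (4 * K))"
  have \<rho>: "0 < \<rho>" "\<rho> \<le> 1" "K * \<rho> \<le> norm D / 4"
    using D0 K(1) by (auto simp: \<rho>_def min_def field_simps)
  \<comment> \<open>The second bound limits the terms with R and g to the other half of the
    contraction factor and the first step from z0 to \<rho> / 4; the third places the predicted
    point z0 + e z1 in the ball.\<close>
  define e0 where "e0 = min 1 (min (\<rho> * norm D / (4 * M)) (\<rho> / (norm z1 + 1)))"
  have e0: "0 < e0" "e0 \<le> 1"
    using \<rho> D0 M0 by (auto simp: e0_def intro!: divide_pos_pos add_nonneg_pos)
  have eM: "e * M \<le> \<rho> * norm D / 4" if "e < e0" for e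
  proof -
    have "e \<le> \<rho> * norm D / (4 * M)" using that by (simp add: e0_def)
    then show ?thesis using M0 by (simp add: field_simps)
  qed
  have ez1: "e * norm z1 \<le> \<rho>" if "0 < e" "e < e0" for e
  proof -
    have "e \<le> \<rho> / (norm z1 + 1)" using that by (simp add: e0_def)
    then have "e * (norm z1 + 1) \<le> \<rho>"
      by (subst (asm) pos_le_divide_eq) (auto intro: add_nonneg_pos)
    then show ?thesis using that by (simp add: algebra_simps)
  qed
  have in_S: "norm z \<le> S" if "z \<in> cball z0 \<rho>" for z
  proof -
    have "norm z \<le> norm z0 + norm (z - z0)" by (metis add.commute diff_add_cancel norm_triangle_ineq)
    then show ?thesis using that \<rho>(2) by (simp add: S_def dist_norm norm_minus_commute)
  qed
  define T where "T e z = z - G z e / D" for e z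
  have contr: "norm (T e z - T e w) \<le> 1 / 2 * norm (z - w)"
    if e: "0 < e" "e < e0" and zw: "z \<in> cball z0 \<rho>" "w \<in> cball z0 \<rho>" for e z w
  proof -
    have "norm (of_real e * (R z - R w) + (of_real e)\<^sup>2 * (g z e - g w e)) \<le> e * M * norm (z - w)"
      using e e0 by (intro small A(3) B(3) in_S zw) auto
    also have "\<dots> \<le> norm D / 4 * norm (z - w)"
    proof -
      have "\<rho> * norm D / 4 \<le> 1 * norm D / 4" using \<rho>(2) D0 by (intro divide_right_mono mult_right_mono) auto
      then show ?thesis using eM[OF e(2)] by (intro mult_right_mono) auto
    qed
    finally have 1: "norm (of_real e * (R z - R w) + (of_real e)\<^sup>2 * (g z e - g w e))
        \<le> norm D / 4 * norm (z - w)" .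
    have "norm (Q z - Q w - D * (z - w)) \<le> K * \<rho> * norm (z - w)"
      by (rule linear[OF zw \<rho>(2)])
    also have "\<dots> \<le> norm D / 4 * norm (z - w)"
      by (intro mult_right_mono \<rho>(3)) auto
    finally have 2: "norm (Q z - Q w - D * (z - w)) \<le> norm D / 4 * norm (z - w)" .
    have "D * (T e z - T e w)
        = - ((Q z - Q w - D * (z - w)) + (of_real e * (R z - R w) + (of_real e)\<^sup>2 * (g z e - g w e)))"
      using D0 by (simp add: T_def G_def field_simps)
    then have "norm D * norm (T e z - T e w)
        = norm ((Q z - Q w - D * (z - w)) + (of_real e * (R z - R w) + (of_real e)\<^sup>2 * (g z e - g w e)))"
      by (metis norm_minus_cancel norm_mult)
    also have "\<dots> \<le> norm D * (1 / 2 * norm (z - w))"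
      using norm_triangle_le[OF add_mono[OF 2 1]] by simp
    finally show ?thesis using D0 by (simp only: mult_le_cancel_left_pos)
  qed
  have self: "T e z \<in> cball z0 \<rho>" if e: "0 < e" "e < e0" and z: "z \<in> cball z0 \<rho>" for e z
  proof -
    have z0: "z0 \<in> cball z0 \<rho>" using \<rho>(1) by simp
    have "norm (G z0 e) \<le> e * M * 1"
      using small[of e "R z0" 1 "g z0 e"] e e0 A(2)[OF in_S[OF z0]] B(2)[of e, OF _ _ in_S[OF z0]]
      by (simp add: G_def root)
    then have "norm (T e z0 - z0) \<le> \<rho> / 4"
      using eM[OF e(2)] D0 by (simp add: T_def norm_divide field_simps)
    moreover have "norm (T e z - T e z0) \<le> 1 / 2 * \<rho>"
      using contr[OF e z z0] z by (simp add: dist_norm norm_minus_commute)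
    ultimately have "norm (T e z - z0) \<le> \<rho>"
      using norm_triangle_ineq[of "T e z - T e z0" "T e z0 - z0"] \<rho>(1) by simp
    then show ?thesis by (simp add: dist_norm norm_minus_commute)
  qed
  have "\<exists>z\<in>cball z0 \<rho>. T e z = z" if e: "0 < e" "e < e0" for e
  proof -
    have "\<exists>!z\<in>cball z0 \<rho>. T e z = z"
    proof (rule Banach_fix)
      show "complete (cball z0 \<rho>)" by (rule compact_imp_complete) simp
      show "T e ` cball z0 \<rho> \<subseteq> cball z0 \<rho>" using self[OF e] by blast
      show "dist (T e x) (T e y) \<le> 1 / 2 * dist x y" if "x \<in> cball z0 \<rho>" "y \<in> cball z0 \<rho>" for x y
        using contr[OF e that] by (simp add: dist_norm)
    qed (use \<rho>(1) in auto)
    then show ?thesis by blast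
  qed
  then obtain Z where Z: "\<And>e. 0 < e \<Longrightarrow> e < e0 \<Longrightarrow> Z e \<in> cball z0 \<rho>"
    "\<And>e. 0 < e \<Longrightarrow> e < e0 \<Longrightarrow> T e (Z e) = Z e"
    by metis
  \<comment> \<open>Taking \<open>w = Z a\<close> gives continuity at \<open>a\<close>; taking \<open>w = z0 + e z1\<close> gives the expansion.\<close>
  have near: "norm (Z e - w) \<le> 2 / norm D * norm (G w e)"
    if e: "0 < e" "e < e0" and w: "w \<in> cball z0 \<rho>" for e w
  proof -
    have "norm (Z e - w) \<le> norm (T e (Z e) - T e w) + norm (T e w - w)"
      using norm_triangle_ineq[of "T e (Z e) - T e w" "T e w - w"] Z(2)[OF e] by simp
    then have "norm (Z e - w) \<le> 2 * norm (T e w - w)"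
      using contr[OF e Z(1)[OF e] w] by linarith
    then show ?thesis by (simp add: T_def norm_divide)
  qed
  have zero: "G (Z e) e = 0" if "0 < e" "e < e0" for e
    using Z(2)[OF that] D0 by (simp add: T_def)
  have cont: "continuous_on {0<..<e0} Z"
    unfolding continuous_on_def
  proof
    fix a assume a: "a \<in> {0<..<e0}"
    have "continuous_on {0<..<1} (\<lambda>e. G (Z a) e)"
      unfolding G_def using lg by (intro continuous_intros) (auto simp: lip_family_def)
    then have "continuous_on {0<..<e0} (\<lambda>e. G (Z a) e)"
      by (rule continuous_on_subset) (use e0 in auto)
    then have "((\<lambda>e. G (Z a) e) \<longlongrightarrow> G (Z a) a) (at a within {0<..<e0})"
      using a by (auto simp: continuous_on_def)
    then have "((\<lambda>e. G (Z a) e) \<longlongrightarrow> 0) (at a within {0<..<e0})"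
      using a zero[of a] by simp
    then have lim: "((\<lambda>e. 2 / norm D * norm (G (Z a) e)) \<longlongrightarrow> 0) (at a within {0<..<e0})"
      using tendsto_mult_right_zero tendsto_norm_zero by blast
    have "((\<lambda>e. Z e - Z a) \<longlongrightarrow> 0) (at a within {0<..<e0})"
    proof (rule Lim_null_comparison[OF _ lim])
      show "\<forall>\<^sub>F e in at a within {0<..<e0}. norm (Z e - Z a) \<le> 2 / norm D * norm (G (Z a) e)"
        unfolding eventually_at_topological
        using near[OF _ _ Z(1)] a by (intro exI[of _ UNIV]) auto
    qed
    then show "(Z \<longlongrightarrow> Z a) (at a within {0<..<e0})" by (simp add: LIM_zero_iff)
  qed
  define C where "C = 2 / norm D * (K * (norm z1)\<^sup>2 + A * norm z1 + B)"
  have exp: "norm (Z e - (z0 + of_real e * z1)) \<le> C * e\<^sup>2" if e: "0 < e" "e < e0" for e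
  proof -
    define p where "p = z0 + of_real e * z1"
    have pz: "norm (p - z0) = e * norm z1" using e by (simp add: p_def norm_mult)
    have p: "p \<in> cball z0 (e * norm z1)" "z0 \<in> cball z0 (e * norm z1)" "p \<in> cball z0 \<rho>"
      using pz ez1[OF e] e by (auto simp: dist_norm norm_minus_commute)
    have 1: "norm (Q p - Q z0 - D * (p - z0)) \<le> K * (norm z1)\<^sup>2 * e\<^sup>2"
      using linear[OF p(1,2)] ez1[OF e] \<rho>(2) pz by (simp add: power2_eq_square mult_ac)
    have "norm (R p - R z0) \<le> A * (e * norm z1)"
      using A(3)[of p z0] in_S[OF p(3)] pz by (simp add: S_def)
    then have 2: "norm (of_real e * (R p - R z0)) \<le> A * norm z1 * e\<^sup>2"
      using e by (simp add: norm_mult power2_eq_square mult_ac)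
    have 3: "norm ((of_real e)\<^sup>2 * g p e) \<le> B * e\<^sup>2"
      using B(2)[of e p] in_S[OF p(3)] e e0 by (simp add: norm_mult norm_power)
    \<comment> \<open>This cancels the order e in \<open>G p e\<close>: the linear part of
      \<open>Q\<close> against e R(z0). The three remaining pieces are the ones bounded above by
      multiples of e^2.\<close>
    have "D * z1 = - R z0" using D0 by (simp add: z1_def D_def)
    then have "D * (p - z0) = - of_real e * R z0" by (simp add: p_def mult.left_commute[of D])
    then have "G p e = (Q p - Q z0 - D * (p - z0)) + of_real e * (R p - R z0) + (of_real e)\<^sup>2 * g p e"
      by (simp add: G_def root algebra_simps)
    then have "norm (G p e) \<le> (K * (norm z1)\<^sup>2 + A * norm z1 + B) * e\<^sup>2"
      using norm_triangle_le[OF add_mono[OF norm_triangle_le[OF add_mono[OF 1 2]] 3]]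
      by (simp only: distrib_right)
    then have "2 / norm D * norm (G p e) \<le> C * e\<^sup>2"
      unfolding C_def mult.assoc by (intro mult_left_mono) auto
    with near[OF e p(3)] show ?thesis unfolding p_def by linarith
  qed
  have "0 \<le> C" using A(1) B(1) K(1) D0 by (simp add: C_def)
  from that[OF e0 this cont zero exp] show thesis .
qed

section \<open>Transfer through a layer\<close>

definition layer_wave :: "real \<Rightarrow> real \<Rightarrow> complex \<Rightarrow> nat \<Rightarrow> complex" where
  "layer_wave v vr w l = w / complex_of_real (if odd l then vr else v)"

text \<open>The factor in front of the derivatives in the second row of each block: \<tau> on the
  resonator side, \<delta> on the background side.\<close>

definition flux_weight :: "real \<Rightarrow> real \<Rightarrow> real \<Rightarrow> nat \<Rightarrow> complex" where
  "flux_weight v vr d l = complex_of_real (if odd l then v / vr else d)"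

lemma sum_lessThan_double:
  fixes f :: "nat \<Rightarrow> 'a::comm_monoid_add"
  shows "(\<Sum>q<2 * n. f q) = (\<Sum>l<n. f (2 * l) + f (2 * l + 1))"
  by (induction n) (simp_all add: add.assoc)

text \<open>The amplitudes of a nontrivial solution form a kernel vector. \<open>A 0 = 0\<close>
  rules out incoming waves and \<open>B N = 0\<close> the solution singular at the origin, so these
  two amplitudes have no column.\<close>

lemma det_transA_eq_0:
  fixes A B :: "nat \<Rightarrow> complex"
  assumes ends: "A 0 = 0" "B N = 0" and nz: "A N \<noteq> 0" "0 < N"
    and field: "\<And>i. 1 \<le> i \<Longrightarrow> i \<le> N \<Longrightarrow>
      A i * sj (layer_wave v vr w i * of_real (r i)) + B i * sh (layer_wave v vr w i * of_real (r i))
      = A (i - 1) * sj (layer_wave v vr w (i - 1) * of_real (r i))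
        + B (i - 1) * sh (layer_wave v vr w (i - 1) * of_real (r i))"
    and flux: "\<And>i. 1 \<le> i \<Longrightarrow> i \<le> N \<Longrightarrow>
      flux_weight v vr d i * (A i * sj' (layer_wave v vr w i * of_real (r i))
        + B i * sh' (layer_wave v vr w i * of_real (r i)))
      = flux_weight v vr d (i - 1) * (A (i - 1) * sj' (layer_wave v vr w (i - 1) * of_real (r i))
        + B (i - 1) * sh' (layer_wave v vr w (i - 1) * of_real (r i)))"
  shows "det (transA N r v vr w d) = 0"
proof -
  \<comment> \<open>The columns carry the unknowns in the order B_0, A_1, B_1, A_2, ..., B_(N-1),
    A_N; the last one makes the vector nonzero.\<close>
  define c where "c q = (if even q then B (q div 2) else A (q div 2 + 1))" for q
  define x where "x = vec (2 * N) c"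
  let ?T = "transA N r v vr w d"
  have T: "?T \<in> carrier_mat (2 * N) (2 * N)" by (simp add: transA_def)
  have x: "x \<in> carrier_vec (2 * N)" by (simp add: x_def)
  have "x $ (2 * N - 1) = A N"
    using nz by (cases N) (auto simp: x_def c_def)
  then have x0: "x \<noteq> 0\<^sub>v (2 * N)" using nz by auto
  have block: "blkM r v vr w d i a 0 * B (i - 1) + blkM r v vr w d i a 1 * A i
      + blkR r v vr w d i a 0 * B i + blkL r v vr w d i a 1 * A (i - 1) = 0"
    if i: "1 \<le> i" "i \<le> N" and a: "a < 2" for i a
  proof -
    have odd: "odd (i - 1) \<longleftrightarrow> even i" using i by presburger
    show ?thesis
      using field[OF i] flux[OF i] a i
      by (cases "odd i"; cases "a = 0")
        (simp_all add: blkM_def blkR_def blkL_def Let_def layer_wave_def flux_weight_def odd algebra_simps)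
  qed
  have "(?T *\<^sub>v x) $ p = 0" if p: "p < 2 * N" for p
  proof -
    define i where "i = p div 2 + 1"
    define a where "a = p mod 2"
    have i: "1 \<le> i" "i \<le> N" and a: "a < 2" using p by (auto simp: i_def a_def)
    define t where "t l b = (if l = i then blkM r v vr w d i a b
       else if l = i + 1 then blkR r v vr w d i a b
       else if l + 1 = i then blkL r v vr w d i a b else 0)" for l b
    have "(?T *\<^sub>v x) $ p = (\<Sum>q<2 * N. t (q div 2 + 1) (q mod 2) * c q)"
      unfolding t_def i_def a_def
      using p by (simp add: transA_def x_def scalar_prod_def Let_def atLeast0LessThan cong: if_cong)
    also have "\<dots> = (\<Sum>l<N. t (l + 1) 0 * B l + t (l + 1) 1 * A (l + 1))"
      by (simp add: sum_lessThan_double c_def)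
    \<comment> \<open>The summation index is one less than the block number. Writing
      \<open>l + 2 = i\<close> instead of a difference avoids truncated subtraction at i =
      1.\<close>
    also have "\<dots> = (\<Sum>l<N. (if l = i - 1 then blkM r v vr w d i a 0 * B (i - 1) + blkM r v vr w d i a 1 * A i else 0)
        + (if l = i then blkR r v vr w d i a 0 * B i else 0)
        + (if l + 2 = i then blkL r v vr w d i a 1 * A (i - 1) else 0))"
      using i by (intro sum.cong refl) (auto simp: t_def blkR_def blkL_def Let_def)
    also have "\<dots> = blkM r v vr w d i a 0 * B (i - 1) + blkM r v vr w d i a 1 * A i
      + blkR r v vr w d i a 0 * B i + blkL r v vr w d i a 1 * A (i - 1)"
    proof -
      \<comment> \<open>The end conditions take care of the boundary rows: the absent right block at
        i = N would multiply \<open>B N = 0\<close>, the absent left block at i = 1 would multiply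
        \<open>A 0 = 0\<close>.\<close>
      have "(\<Sum>l<N. if l = i then blkR r v vr w d i a 0 * B i else 0) = blkR r v vr w d i a 0 * B i"
        using i ends by (cases "i = N") auto
      moreover have "(\<Sum>l<N. if l + 2 = i then blkL r v vr w d i a 1 * A (i - 1) else 0)
          = blkL r v vr w d i a 1 * A (i - 1)"
      proof (cases "i = 1")
        case False
        then have "l + 2 = i \<longleftrightarrow> l = i - 2" for l using i by auto
        then show ?thesis using i False by (simp add: sum.delta)
      qed (use ends in simp)
      moreover have "i - 1 < N" using i by auto
      ultimately show ?thesis by (simp add: sum.distrib)
    qed
    also have "\<dots> = 0" by (rule block[OF i a])
    finally show ?thesis .
  qed
  then have "?T *\<^sub>v x = 0\<^sub>v (2 * N)" using T by (intro eq_vecI) auto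
  with x x0 show ?thesis using det_0_iff_vec_prod_zero[OF T] by blast
qed

text \<open>From \<open>u\<close> and the flux \<open>f = x\<^sup>2 u'\<close> at radius \<open>a\<close> to those at \<open>b\<close>: since \<open>x u\<close> solves
  \<open>w'' = - k\<^sup>2 w\<close>, its value and derivative at \<open>b\<close> come from addition formulas in \<open>k (b - a)\<close>.\<close>

definition transfer_field :: "complex \<Rightarrow> real \<Rightarrow> real \<Rightarrow> complex \<Rightarrow> complex \<Rightarrow> complex" where
  "transfer_field k a b u f =
    ((of_real a * cos (k * of_real (b - a)) + of_real (b - a) * sj (k * of_real (b - a))) * u
      + of_real ((b - a) / a) * sj (k * of_real (b - a)) * f) / of_real b"

definition transfer_flux :: "complex \<Rightarrow> real \<Rightarrow> real \<Rightarrow> complex \<Rightarrow> complex \<Rightarrow> complex" where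
  "transfer_flux k a b u f =
    k\<^sup>2 * (of_real ((b - a) ^ 3) * chi (k * of_real (b - a))
          - of_real (a * b * (b - a)) * sj (k * of_real (b - a))) * u
      + (of_real b * cos (k * of_real (b - a)) - of_real (b - a) * sj (k * of_real (b - a)))
        / of_real a * f"

lemma layer_field:
  assumes "k \<noteq> 0" "x > 0"
  shows "A * sj (k * of_real x) + B * sh (k * of_real x)
    = (A * sin (k * of_real x) - \<i> * B * exp (\<i> * (k * of_real x))) / (k * of_real x)"
  using assms by (simp add: sj_def sh_def field_simps)

lemma layer_flux:
  assumes "k \<noteq> 0" "x > 0"
  shows "k * (of_real x)\<^sup>2 * (A * sj' (k * of_real x) + B * sh' (k * of_real x))
    = of_real x * (A * cos (k * of_real x) + B * exp (\<i> * (k * of_real x)))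
      - (A * sin (k * of_real x) - \<i> * B * exp (\<i> * (k * of_real x))) / k"
proof -
  have "k * of_real x \<noteq> 0" using assms by simp
  then show ?thesis
    using assms
    by (simp add: sj'_eq sh'_eq chi_def sj_def field_simps power2_eq_square)
qed

text \<open>In terms of the amplitudes, k x u is A sin(k x) - \<i> B exp(\<i> k x) and (x u)' is A
  cos(k x) + B exp(\<i> k x). Their values at a determine A and B, and a shift of the argument by k
  (b - a) acts on this pair as a rotation, which gives the values at b.\<close>

lemma layer_coefficients:
  assumes k: "k \<noteq> 0" and a: "0 < a" and b: "a < b"
  obtains A B where
    "A * sj (k * of_real a) + B * sh (k * of_real a) = u"
    "k * (of_real a)\<^sup>2 * (A * sj' (k * of_real a) + B * sh' (k * of_real a)) = f"
    "A * sj (k * of_real b) + B * sh (k * of_real b) = transfer_field k a b u f"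
    "k * (of_real b)\<^sup>2 * (A * sj' (k * of_real b) + B * sh' (k * of_real b)) = transfer_flux k a b u f"
proof -
  define y where "y = k * of_real a"
  define t where "t = k * of_real (b - a)"
  \<comment> \<open>The derivative of x u at a, since (x u)' = u + x u' = u + f / x.\<close>
  define W where "W = u + f / of_real a"
  \<comment> \<open>Subtracting \<i> times the sine combination from the cosine combination
    eliminates B and leaves A exp(-\<i> y).\<close>
  define A where "A = exp (\<i> * y) * (W - \<i> * (y * u))"
  define B where "B = exp (- (\<i> * y)) * (W - A * cos y)"
  have t0: "t \<noteq> 0" using k b by (simp add: t_def)
  have kb: "k * of_real b = y + t" by (simp add: y_def t_def algebra_simps)
  have e: "exp (\<i> * y) * exp (- (\<i> * y)) = 1" by (simp add: exp_minus)
  have ey: "exp (\<i> * y) = cos y + \<i> * sin y" "exp (- (\<i> * y)) = cos y - \<i> * sin y"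
    using exp_Euler[of y] exp_Euler[of "- y"] by simp_all
  have cos: "A * cos y + B * exp (\<i> * y) = W"
    unfolding B_def using e by (simp add: algebra_simps)
  have "A * sin y - \<i> * B * exp (\<i> * y)
      = \<i> * (A * (cos y - \<i> * sin y)) - \<i> * (A * cos y + B * exp (\<i> * y))"
    by (simp add: algebra_simps)
  then have sin1: "A * sin y - \<i> * B * exp (\<i> * y) = \<i> * (A * exp (- (\<i> * y))) - \<i> * W"
    unfolding cos ey(2) .
  have A_exp: "A * exp (- (\<i> * y)) = W - \<i> * (y * u)"
    unfolding A_def using e by (simp add: algebra_simps)
  have sin: "A * sin y - \<i> * B * exp (\<i> * y) = y * u"
    unfolding sin1 A_exp by (simp add: algebra_simps)
  have cos2: "A * cos (y + t) + B * exp (\<i> * (y + t)) = W * cos t - y * u * sin t"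
  proof -
    have "A * cos (y + t) + B * exp (\<i> * (y + t))
        = (A * cos y + B * exp (\<i> * y)) * cos t - (A * sin y - \<i> * B * exp (\<i> * y)) * sin t"
      by (simp add: cos_add exp_add distrib_left exp_Euler[of t] algebra_simps)
    then show ?thesis unfolding cos sin .
  qed
  have sin2: "A * sin (y + t) - \<i> * B * exp (\<i> * (y + t)) = y * u * cos t + W * sin t"
  proof -
    have "A * sin (y + t) - \<i> * B * exp (\<i> * (y + t))
        = (A * sin y - \<i> * B * exp (\<i> * y)) * cos t + (A * cos y + B * exp (\<i> * y)) * sin t"
      by (simp add: sin_add exp_add distrib_left exp_Euler[of t] algebra_simps)
    then show ?thesis unfolding cos sin .
  qed
  have b0: "0 < b" using a b by simp
  have scale: "c * sj (k * c) = sin (k * c) / k"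
      "c ^ 3 * chi (k * c) = (c * cos (k * c) - sin (k * c) / k) / k\<^sup>2" if "c \<noteq> 0" for c
    using that k by (simp_all add: sj_def chi_def field_simps power2_eq_square power3_eq_cube)
  have sjt: "of_real (b - a) * sj t = sin t / k"
    and chit: "of_real ((b - a) ^ 3) * chi t = (of_real (b - a) * cos t - sin t / k) / k\<^sup>2"
    unfolding t_def of_real_power using b by (intro scale; simp)+
  show ?thesis
  proof (rule that[of A B])
    show "A * sj (k * of_real a) + B * sh (k * of_real a) = u"
      using layer_field[OF k a, of A B] k a sin by (simp add: y_def)
    show "k * (of_real a)\<^sup>2 * (A * sj' (k * of_real a) + B * sh' (k * of_real a)) = f"
      unfolding layer_flux[OF k a] unfolding y_def[symmetric] cos sin using k a by (simp add: W_def y_def field_simps)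
    show "A * sj (k * of_real b) + B * sh (k * of_real b) = transfer_field k a b u f"
      unfolding layer_field[OF k b0] transfer_field_def unfolding kb sin2 t_def[symmetric]
    proof -
      have "(of_real a * cos t + of_real (b - a) * sj t) * u + of_real ((b - a) / a) * sj t * f
          = (y * u * cos t + W * sin t) / k"
        unfolding of_real_divide times_divide_eq_left sjt using k a
        by (simp add: W_def y_def field_simps)
      then show "(y * u * cos t + W * sin t) / (y + t)
          = ((of_real a * cos t + of_real (b - a) * sj t) * u + of_real ((b - a) / a) * sj t * f) / of_real b"
        unfolding kb[symmetric] by simp
    qed
    have "transfer_flux k a b u f
        = (of_real (b - a) * cos t - sin t / k - k * of_real a * of_real b * sin t) * u
          + (of_real b * cos t - sin t / k) / of_real a * f"
    proof -
      have "k\<^sup>2 * (of_real ((b - a) ^ 3) * chi t - of_real (a * b * (b - a)) * sj t)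
          = of_real (b - a) * cos t - sin t / k - k * of_real a * of_real b * sin t"
        unfolding of_real_mult mult.assoc chit sjt using k by (simp add: field_simps power2_eq_square)
      then show ?thesis unfolding transfer_flux_def t_def[symmetric] sjt by simp
    qed
    also have "\<dots> = of_real b * (W * cos t - y * u * sin t) - (y * u * cos t + W * sin t) / k"
      using k a by (simp add: W_def y_def field_simps)
    finally show "k * (of_real b)\<^sup>2 * (A * sj' (k * of_real b) + B * sh' (k * of_real b))
        = transfer_flux k a b u f"
      unfolding layer_flux[OF k b0] unfolding kb cos2 sin2 by simp
  qed
qed

section \<open>Expansions of the transfer\<close>

text \<open>The limit is the static field: the flux is conserved, and integrating u' = f / x^2 from
  a to b adds (1/a - 1/b) f to the field.\<close>

lemma expands_transfer_background:
  assumes ab: "0 < a" "a < b" and u: "expands u u0" and f: "expands f f0"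
  shows "expands (\<lambda>z e. transfer_field (of_real e * z * c) a b (u z e) (f z e))
          (\<lambda>z. u0 z + of_real ((b - a) / (a * b)) * f0 z)"
    and "expands (\<lambda>z e. transfer_flux (of_real e * z * c) a b (u z e) (f z e)) f0"
proof -
  let ?c = "of_real (b - a) :: complex"
  note trig = expands_trig[where c = "c * ?c"]
  have k: "of_real e * z * c * ?c = of_real e * z * (c * ?c)" for e z by (simp add: mult.assoc)
  show "expands (\<lambda>z e. transfer_field (of_real e * z * c) a b (u z e) (f z e))
          (\<lambda>z. u0 z + of_real ((b - a) / (a * b)) * f0 z)"
  proof (rule expands_cong)
    show "expands (\<lambda>z e. (1 / of_real b) * ((of_real a * cos (of_real e * z * (c * ?c))
          + ?c * sj (of_real e * z * (c * ?c))) * u z e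
        + of_real ((b - a) / a) * sj (of_real e * z * (c * ?c)) * f z e))
      (\<lambda>z. (1 / of_real b) * ((of_real a * 1 + ?c * 1) * u0 z + of_real ((b - a) / a) * 1 * f0 z))"
      by (intro expands_mult expands_add expands_const trig u f)
  qed (use ab in \<open>simp_all add: transfer_field_def k field_simps\<close>)
  show "expands (\<lambda>z e. transfer_flux (of_real e * z * c) a b (u z e) (f z e)) f0"
  proof (rule expands_cong)
    show "expands (\<lambda>z e. (of_real e)\<^sup>2 * (z * z * (c * c)) * (of_real ((b - a) ^ 3) * chi (of_real e * z * (c * ?c))
          + of_real (- (a * b * (b - a))) * sj (of_real e * z * (c * ?c))) * u z e
        + (1 / of_real a) * (of_real b * cos (of_real e * z * (c * ?c)) + (- ?c) * sj (of_real e * z * (c * ?c))) * f z e)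
      (\<lambda>z. 0 * (z * z * (c * c)) * (of_real ((b - a) ^ 3) * (- 1 / 3) + of_real (- (a * b * (b - a))) * 1) * u0 z
        + (1 / of_real a) * (of_real b * 1 + (- ?c) * 1) * f0 z)"
      by (intro expands_mult expands_add expands_const expands_eps2 expands_var trig u f)
  qed (use ab in \<open>simp_all add: transfer_flux_def k power2_eq_square field_simps\<close>)
qed

text \<open>The incoming flux e^2 f is too weak to change the field at leading order. By (x^2 u')' =
  - k^2 x^2 u with k = e z, the flux divided by e^2 loses z^2 times the integral of x^2 u, with u
  constant across the layer.\<close>

lemma expands_transfer_resonator:
  assumes ab: "0 < a" "a < b" and u: "expands u u0" and f: "expands f f0"
  shows "expands (\<lambda>z e. transfer_field (of_real e * z) a b (u z e) ((of_real e)\<^sup>2 * f z e)) u0"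
    and "expands (\<lambda>z e. transfer_flux (of_real e * z) a b (u z e) ((of_real e)\<^sup>2 * f z e) / (of_real e)\<^sup>2)
          (\<lambda>z. f0 z - z\<^sup>2 * of_real ((b ^ 3 - a ^ 3) / 3) * u0 z)"
proof -
  let ?c = "of_real (b - a) :: complex"
  note trig = expands_trig[where c = "?c"]
  show "expands (\<lambda>z e. transfer_field (of_real e * z) a b (u z e) ((of_real e)\<^sup>2 * f z e)) u0"
  proof (rule expands_cong)
    show "expands (\<lambda>z e. (1 / of_real b) * ((of_real a * cos (of_real e * z * ?c)
          + ?c * sj (of_real e * z * ?c)) * u z e
        + of_real ((b - a) / a) * sj (of_real e * z * ?c) * ((of_real e)\<^sup>2 * f z e)))
      (\<lambda>z. (1 / of_real b) * ((of_real a * 1 + ?c * 1) * u0 z + of_real ((b - a) / a) * 1 * (0 * f0 z)))"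
      by (intro expands_mult expands_add expands_const expands_eps2 trig u f)
  qed (use ab in \<open>simp_all add: transfer_field_def\<close>)
  show "expands (\<lambda>z e. transfer_flux (of_real e * z) a b (u z e) ((of_real e)\<^sup>2 * f z e) / (of_real e)\<^sup>2)
          (\<lambda>z. f0 z - z\<^sup>2 * of_real ((b ^ 3 - a ^ 3) / 3) * u0 z)"
  proof (rule expands_cong)
    show "expands (\<lambda>z e. z * z * (of_real ((b - a) ^ 3) * chi (of_real e * z * ?c)
          + of_real (- (a * b * (b - a))) * sj (of_real e * z * ?c)) * u z e
        + (1 / of_real a) * (of_real b * cos (of_real e * z * ?c) + (- ?c) * sj (of_real e * z * ?c)) * f z e)
      (\<lambda>z. z * z * (of_real ((b - a) ^ 3) * (- 1 / 3) + of_real (- (a * b * (b - a))) * 1) * u0 z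
        + (1 / of_real a) * (of_real b * 1 + (- ?c) * 1) * f0 z)"
      by (intro expands_mult expands_add expands_const expands_var trig u f)
    show "f0 z - z\<^sup>2 * of_real ((b ^ 3 - a ^ 3) / 3) * u0 z
       = z * z * (of_real ((b - a) ^ 3) * (- 1 / 3) + of_real (- (a * b * (b - a))) * 1) * u0 z
        + (1 / of_real a) * (of_real b * 1 + (- ?c) * 1) * f0 z" for z
    proof -
      have "- ((b ^ 3 - a ^ 3) / 3) = (b - a) ^ 3 * (- 1 / 3) + - (a * b * (b - a))"
        by (simp add: power3_eq_cube field_simps)
      then have 1: "of_real ((b - a) ^ 3) * (- 1 / 3) + of_real (- (a * b * (b - a))) * 1
          = complex_of_real (- ((b ^ 3 - a ^ 3) / 3))"
        by simp
      have 2: "(1 / of_real a) * (of_real b * 1 + (- ?c) * 1) = (1::complex)"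
        using ab by (simp add: field_simps)
      show ?thesis unfolding 1 2 by (simp add: power2_eq_square)
    qed
  qed (use ab in \<open>simp_all add: transfer_flux_def power2_eq_square field_simps\<close>)
qed

section \<open>From the scaled root back to the frequency\<close>

lemma continuous_scaled_root:
  assumes Z: "continuous_on {0<..<e0} Z"
    and est: "\<And>e. 0 < e \<Longrightarrow> e < e0 \<Longrightarrow>
      norm (Z e - (of_real x + of_real e * (- \<i> * of_real b))) \<le> C * e\<^sup>2"
    and pos: "0 < x" "0 < e0" "e0 \<le> 1" "0 \<le> C" "0 < \<nu>"
  defines "\<omega> \<equiv> \<lambda>\<delta>. of_real \<nu> * (of_real (sqrt \<delta>) * Z (sqrt \<delta>))"
  obtains \<delta>0 where "0 < \<delta>0" "continuous_on {0<..<\<delta>0} \<omega>"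
    "\<And>\<delta>. 0 < \<delta> \<Longrightarrow> \<delta> < \<delta>0 \<Longrightarrow> sqrt \<delta> < e0 \<and> Re (Z (sqrt \<delta>)) > 0 \<and> Re (\<omega> \<delta>) > 0"
    "(\<lambda>\<delta>. \<omega> \<delta> - (of_real (\<nu> * x * sqrt \<delta>) - \<i> * of_real (\<nu> * b * \<delta>)))
       \<in> O[at_right 0](\<lambda>\<delta>. complex_of_real (\<delta> powr (3/2)))"
proof -
  \<comment> \<open>For e < x / (C + 1) and e < 1 the error C e^2 stays below x, so the real part
    remains positive.\<close>
  define e1 where "e1 = min e0 (x / (C + 1))"
  have e1: "0 < e1" "e1 \<le> e0" using pos by (auto simp: e1_def)
  have sq: "0 < sqrt \<delta>" "sqrt \<delta> < e1" if "0 < \<delta>" "\<delta> < e1\<^sup>2" for \<delta>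
    using that e1 by (auto intro: real_less_lsqrt)
  have reZ: "Re (Z e) > 0" if e: "0 < e" "e < e1" for e
  proof -
    have "e * (C + 1) < x" using e pos unfolding e1_def by (simp add: pos_less_divide_eq)
    moreover have "C * e\<^sup>2 \<le> C * e"
      using e e1 pos by (intro mult_left_mono) (auto simp: power2_eq_square)
    ultimately have "C * e\<^sup>2 < x" using e by (simp add: algebra_simps)
    moreover have "x - Re (Z e) \<le> C * e\<^sup>2"
      using est[of e] abs_Re_le_cmod[of "Z e - (of_real x + of_real e * (- \<i> * of_real b))"] e e1
      by simp
    ultimately show ?thesis by simp
  qed
  show thesis
  proof (rule that[of "e1\<^sup>2"])
    show "0 < e1\<^sup>2" using e1 by simp
    show "continuous_on {0<..<e1\<^sup>2} \<omega>"
      unfolding \<omega>_def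
      by (intro continuous_intros continuous_on_compose2[OF Z]) (use sq e1 in force)
    show "sqrt \<delta> < e0 \<and> Re (Z (sqrt \<delta>)) > 0 \<and> Re (\<omega> \<delta>) > 0" if "0 < \<delta>" "\<delta> < e1\<^sup>2" for \<delta>
      using sq[OF that] e1 reZ[OF sq[OF that]] pos that by (simp add: \<omega>_def)
    have "norm (\<omega> \<delta> - (of_real (\<nu> * x * sqrt \<delta>) - \<i> * of_real (\<nu> * b * \<delta>)))
        \<le> \<nu> * C * norm (complex_of_real (\<delta> powr (3/2)))" if d: "0 < \<delta>" "\<delta> < e1\<^sup>2" for \<delta>
    proof -
      define e where "e = sqrt \<delta>"
      have e: "0 < e" "e < e0" "\<delta> = e * e" using sq[OF d] e1 d by (auto simp: e_def)
      have "\<delta> powr (3/2) = \<delta> powr (1 + 1/2)" by simp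
      also have "\<dots> = e * e\<^sup>2"
      proof -
        have "\<delta> powr (1/2) = e"
          using powr_half_sqrt[of \<delta>] d by (simp add: e_def)
        moreover have "\<delta> powr 1 = e * e"
          unfolding powr_one[OF less_imp_le[OF d(1)]] by (rule e(3))
        ultimately show ?thesis unfolding powr_add by (simp only: power2_eq_square mult_ac)
      qed
      finally have p: "\<delta> powr (3/2) = e * e\<^sup>2" .
      \<comment> \<open>The prefactor \<nu> e turns the error e^2 of the scaled root into e^3 =
        \<delta>^(3/2).\<close>
      have "\<omega> \<delta> - (of_real (\<nu> * x * sqrt \<delta>) - \<i> * of_real (\<nu> * b * \<delta>))
          = of_real (\<nu> * e) * (Z e - (of_real x + of_real e * (- \<i> * of_real b)))"
        using e unfolding \<omega>_def e_def[symmetric] by (simp add: algebra_simps)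
      also have "norm \<dots> = \<nu> * e * norm (Z e - (of_real x + of_real e * (- \<i> * of_real b)))"
        using e pos by (simp add: norm_mult)
      also have "\<dots> \<le> \<nu> * e * (C * e\<^sup>2)"
        using e pos by (intro mult_left_mono est) auto
      also have "\<dots> = \<nu> * C * norm (complex_of_real (\<delta> powr (3/2)))"
        unfolding p norm_of_real using e(1) by (simp add: abs_mult)
      finally show ?thesis .
    qed
    then show "(\<lambda>\<delta>. \<omega> \<delta> - (of_real (\<nu> * x * sqrt \<delta>) - \<i> * of_real (\<nu> * b * \<delta>)))
       \<in> O[at_right 0](\<lambda>\<delta>. complex_of_real (\<delta> powr (3/2)))"
      using e1 by (intro bigoI[of _ "\<nu> * C"] eventually_at_rightI[of 0 "e1\<^sup>2"]) auto
  qed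
qed

section \<open>Vanishing of the determinant\<close>

text \<open>Neighbouring layers share the state (U i, F i) at r_i. After multiplication by w x^2
  both sides of the flux condition equal v d F i: in a resonator the weight v / vr meets the flux d
  F i, in the background the weight d meets F i.\<close>

lemma det_transA_eq_0_states:
  fixes A B U F :: "nat \<Rightarrow> complex"
  assumes v: "0 < v" "0 < vr" and w: "w \<noteq> 0" and r: "\<And>i. 1 \<le> i \<Longrightarrow> i \<le> N \<Longrightarrow> 0 < r i"
    and ends: "A 0 = 0" "B N = 0" and nz: "A N \<noteq> 0" "0 < N"
    and state: "\<And>i l. 1 \<le> i \<Longrightarrow> i \<le> N \<Longrightarrow> l = i \<or> l + 1 = i \<Longrightarrow>
      A l * sj (layer_wave v vr w l * of_real (r i)) + B l * sh (layer_wave v vr w l * of_real (r i)) = U i \<and>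
      layer_wave v vr w l * (of_real (r i))\<^sup>2 * (A l * sj' (layer_wave v vr w l * of_real (r i))
        + B l * sh' (layer_wave v vr w l * of_real (r i))) = (if odd l then of_real d else 1) * F i"
  shows "det (transA N r v vr w d) = 0"
proof (rule det_transA_eq_0[where A = A and B = B])
  fix i assume i: "1 \<le> i" "i \<le> N"
  define x where "x = complex_of_real (r i)"
  have x: "x \<noteq> 0" using r[OF i] by (simp add: x_def)
  have prev: "i - 1 + 1 = i" using i by simp
  show "A i * sj (layer_wave v vr w i * of_real (r i)) + B i * sh (layer_wave v vr w i * of_real (r i))
      = A (i - 1) * sj (layer_wave v vr w (i - 1) * of_real (r i))
        + B (i - 1) * sh (layer_wave v vr w (i - 1) * of_real (r i))"
    using state[OF i, of i] state[OF i, of "i - 1"] prev by simp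
  have common: "flux_weight v vr d l * X * (w * x\<^sup>2) = of_real (v * d) * F i"
    if "layer_wave v vr w l * x\<^sup>2 * X = (if odd l then of_real d else 1) * F i" for l X
  proof -
    have "flux_weight v vr d l * X * (w * x\<^sup>2)
        = of_real (if odd l then v else v * d) * (layer_wave v vr w l * x\<^sup>2 * X)"
      using v by (simp add: flux_weight_def layer_wave_def)
    then show ?thesis unfolding that by simp
  qed
  have "w * x\<^sup>2 \<noteq> 0" using w x by simp
  moreover have "flux_weight v vr d i * (A i * sj' (layer_wave v vr w i * x) + B i * sh' (layer_wave v vr w i * x))
        * (w * x\<^sup>2) = of_real (v * d) * F i"
    using state[OF i, of i] by (intro common) (simp add: x_def)
  moreover have "flux_weight v vr d (i - 1) * (A (i - 1) * sj' (layer_wave v vr w (i - 1) * x)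
        + B (i - 1) * sh' (layer_wave v vr w (i - 1) * x)) * (w * x\<^sup>2) = of_real (v * d) * F i"
    using state[OF i, of "i - 1"] prev by (intro common) (simp add: x_def)
  ultimately show "flux_weight v vr d i * (A i * sj' (layer_wave v vr w i * of_real (r i))
        + B i * sh' (layer_wave v vr w i * of_real (r i)))
      = flux_weight v vr d (i - 1) * (A (i - 1) * sj' (layer_wave v vr w (i - 1) * of_real (r i))
        + B (i - 1) * sh' (layer_wave v vr w (i - 1) * of_real (r i)))"
    unfolding x_def by (metis mult_right_cancel)
qed (use ends nz in auto)

lemma core_flux:
  assumes "k \<noteq> 0" "x > 0"
  shows "k * (of_real x)\<^sup>2 * sj' (k * of_real x) = k\<^sup>2 * of_real (x ^ 3) * chi (k * of_real x)"
  using assms by (simp add: sj'_eq power2_eq_square power3_eq_cube mult_ac)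

text \<open>Rests on h'(t) = (\<i> - 1/t) h(t). The summand \<i> k x^2 is the radiation loss, from
  which the imaginary part of the resonances arises.\<close>

lemma outgoing_wave:
  assumes "k \<noteq> 0" "x > 0"
  obtains B where "B * sh (k * of_real x) = u"
    "k * (of_real x)\<^sup>2 * (B * sh' (k * of_real x)) = (\<i> * k * (of_real x)\<^sup>2 - of_real x) * u"
proof (rule that[of "u / sh (k * of_real x)"])
  have nz: "sh (k * of_real x) \<noteq> 0" using assms by (simp add: sh_def)
  then show "u / sh (k * of_real x) * sh (k * of_real x) = u" by simp
  have kx: "k * of_real x \<noteq> 0" using assms by simp
  have "k * (of_real x)\<^sup>2 * sh' (k * of_real x)
      = (\<i> * k * (of_real x)\<^sup>2 - of_real x) * sh (k * of_real x)"
    unfolding sh'_eq[OF kx] sh_def using assms by (simp add: field_simps power2_eq_square)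
  then have "k * (of_real x)\<^sup>2 * (u / sh (k * of_real x) * sh' (k * of_real x))
      = u / sh (k * of_real x) * ((\<i> * k * (of_real x)\<^sup>2 - of_real x) * sh (k * of_real x))"
    by (metis mult.left_commute)
  then show "k * (of_real x)\<^sup>2 * (u / sh (k * of_real x) * sh' (k * of_real x))
      = (\<i> * k * (of_real x)\<^sup>2 - of_real x) * u"
    using nz by simp
qed

text \<open>State at \<open>r\<^sub>1\<close> reached from the state \<open>(u, f)\<close> at \<open>r\<^sub>3\<close>. Continuity of \<open>u' / \<rho>\<close> makes the flux in a
  resonator \<open>\<delta>\<close> times the flux in the background; \<open>f\<close> always denotes the background value.\<close>

definition outer_u :: "complex \<Rightarrow> complex \<Rightarrow> real \<Rightarrow> (nat \<Rightarrow> real) \<Rightarrow> complex \<Rightarrow> complex \<Rightarrow> complex" where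
  "outer_u k kr d r u f = transfer_field kr (r 2) (r 1) (transfer_field k (r 3) (r 2) u f)
     (of_real d * transfer_flux k (r 3) (r 2) u f)"

definition outer_f :: "complex \<Rightarrow> complex \<Rightarrow> real \<Rightarrow> (nat \<Rightarrow> real) \<Rightarrow> complex \<Rightarrow> complex \<Rightarrow> complex" where
  "outer_f k kr d r u f = transfer_flux kr (r 2) (r 1) (transfer_field k (r 3) (r 2) u f)
     (of_real d * transfer_flux k (r 3) (r 2) u f) / of_real d"

text \<open>The part common to three and four layers. Starting from an arbitrary state at r_3,
  layers 2, 1 and 0 are filled outwards, and \<open>rad\<close> lets the exterior be a purely
  outgoing wave. What lies inside r_3 is left to the caller, hence the restriction l < 3.\<close>

lemma outer_layers:
  assumes v: "0 < v" "0 < vr" and w: "w \<noteq> 0" and d: "d \<noteq> 0"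
    and r: "0 < r 3" "r 3 < r 2" "r 2 < r 1"
    and rad: "outer_f (w / of_real v) (w / of_real vr) d r u f
      = (\<i> * (w / of_real v) * (of_real (r 1))\<^sup>2 - of_real (r 1)) * outer_u (w / of_real v) (w / of_real vr) d r u f"
  obtains A B U F :: "nat \<Rightarrow> complex" where "A 0 = 0" "U (3::nat) = u" "F 3 = f"
    "\<And>i l. 1 \<le> i \<Longrightarrow> i \<le> 3 \<Longrightarrow> l < 3 \<Longrightarrow> l = i \<or> l + 1 = i \<Longrightarrow>
      A l * sj (layer_wave v vr w l * of_real (r i)) + B l * sh (layer_wave v vr w l * of_real (r i)) = U i \<and>
      layer_wave v vr w l * (of_real (r i))\<^sup>2 * (A l * sj' (layer_wave v vr w l * of_real (r i))
        + B l * sh' (layer_wave v vr w l * of_real (r i))) = (if odd l then of_real d else 1) * F i"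
proof -
  define k where "k = w / complex_of_real v"
  define kr where "kr = w / complex_of_real vr"
  have k: "k \<noteq> 0" "kr \<noteq> 0" using v w by (auto simp: k_def kr_def)
  define u2 f2 u1 f1 where "u2 = transfer_field k (r 3) (r 2) u f" "f2 = transfer_flux k (r 3) (r 2) u f"
    "u1 = transfer_field kr (r 2) (r 1) u2 (of_real d * f2)"
    "f1 = transfer_flux kr (r 2) (r 1) u2 (of_real d * f2) / of_real d"
  note defs = this
  obtain A2 B2 where AB2: "A2 * sj (k * of_real (r 3)) + B2 * sh (k * of_real (r 3)) = u"
    "k * (of_real (r 3))\<^sup>2 * (A2 * sj' (k * of_real (r 3)) + B2 * sh' (k * of_real (r 3))) = f"
    "A2 * sj (k * of_real (r 2)) + B2 * sh (k * of_real (r 2)) = u2"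
    "k * (of_real (r 2))\<^sup>2 * (A2 * sj' (k * of_real (r 2)) + B2 * sh' (k * of_real (r 2))) = f2"
    unfolding defs by (rule layer_coefficients[OF k(1) r(1,2)])
  have r2: "0 < r 2" "0 < r 1" using r by auto
  obtain A1 B1 where AB1: "A1 * sj (kr * of_real (r 2)) + B1 * sh (kr * of_real (r 2)) = u2"
    "kr * (of_real (r 2))\<^sup>2 * (A1 * sj' (kr * of_real (r 2)) + B1 * sh' (kr * of_real (r 2))) = of_real d * f2"
    "A1 * sj (kr * of_real (r 1)) + B1 * sh (kr * of_real (r 1)) = u1"
    "kr * (of_real (r 1))\<^sup>2 * (A1 * sj' (kr * of_real (r 1)) + B1 * sh' (kr * of_real (r 1))) = of_real d * f1"
  proof (rule layer_coefficients[OF k(2) r2(1) r(3), of u2 "of_real d * f2"])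
    fix A B
    assume "A * sj (kr * of_real (r 2)) + B * sh (kr * of_real (r 2)) = u2"
    "kr * (of_real (r 2))\<^sup>2 * (A * sj' (kr * of_real (r 2)) + B * sh' (kr * of_real (r 2))) = of_real d * f2"
    "A * sj (kr * of_real (r 1)) + B * sh (kr * of_real (r 1)) = transfer_field kr (r 2) (r 1) u2 (of_real d * f2)"
    "kr * (of_real (r 1))\<^sup>2 * (A * sj' (kr * of_real (r 1)) + B * sh' (kr * of_real (r 1)))
      = transfer_flux kr (r 2) (r 1) u2 (of_real d * f2)"
    then show thesis using d by (intro that[of A B]) (simp_all add: defs)
  qed
  obtain B0 where B0: "B0 * sh (k * of_real (r 1)) = u1"
    "k * (of_real (r 1))\<^sup>2 * (B0 * sh' (k * of_real (r 1))) = (\<i> * k * (of_real (r 1))\<^sup>2 - of_real (r 1)) * u1"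
    by (rule outgoing_wave[OF k(1) r2(2)])
  have rad': "(\<i> * k * (of_real (r 1))\<^sup>2 - of_real (r 1)) * u1 = f1"
    using rad by (simp add: outer_u_def outer_f_def defs k_def kr_def)
  have wave: "layer_wave v vr w 0 = k" "layer_wave v vr w 1 = kr" "layer_wave v vr w 2 = k"
    by (simp_all add: layer_wave_def k_def kr_def)
  show thesis
  proof (rule that[of "\<lambda>l. if l = 0 then 0 else if l = 1 then A1 else A2"
        "\<lambda>i. if i = 1 then u1 else if i = 2 then u2 else u"
        "\<lambda>i. if i = 1 then f1 else if i = 2 then f2 else f"
        "\<lambda>l. if l = 0 then B0 else if l = 1 then B1 else B2"])
    fix i l :: nat
    assume "1 \<le> i" "i \<le> 3" "l < 3" "l = i \<or> l + 1 = i"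
    then have "l = 0 \<and> i = 1 \<or> l = 1 \<and> i = 1 \<or> l = 1 \<and> i = 2 \<or> l = 2 \<and> i = 2 \<or> l = 2 \<and> i = 3"
      by presburger
    then consider "l = 0" "i = 1" | "l = 1" "i = 1" | "l = 1" "i = 2" | "l = 2" "i = 2" | "l = 2" "i = 3"
      by blast
    then show "(if l = 0 then 0 else if l = 1 then A1 else A2) * sj (layer_wave v vr w l * of_real (r i)) +
       (if l = 0 then B0 else if l = 1 then B1 else B2) * sh (layer_wave v vr w l * of_real (r i)) =
       (if i = 1 then u1 else if i = 2 then u2 else u) \<and>
       layer_wave v vr w l * (of_real (r i))\<^sup>2 *
       ((if l = 0 then 0 else if l = 1 then A1 else A2) * sj' (layer_wave v vr w l * of_real (r i)) +
        (if l = 0 then B0 else if l = 1 then B1 else B2) * sh' (layer_wave v vr w l * of_real (r i))) =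
       (if odd l then of_real d else 1) * (if i = 1 then f1 else if i = 2 then f2 else f)"
      by cases (use AB1 AB2 B0 rad' in \<open>simp_all add: wave wave(2)[unfolded One_nat_def]\<close>)
  qed simp_all
qed

text \<open>The core is a resonator carrying the regular wave with amplitude 1; its flux at r_3 is d
  f by \<open>core_flux\<close>.\<close>

lemma det_transA_3:
  assumes v: "0 < v" "0 < vr" and w: "w \<noteq> 0" and d: "d \<noteq> 0"
    and r: "0 < r 3" "r 3 < r 2" "r 2 < r 1"
  defines "k \<equiv> w / complex_of_real v" and "kr \<equiv> w / complex_of_real vr"
  assumes u: "u = sj (kr * of_real (r 3))" and f: "of_real d * f = kr\<^sup>2 * of_real (r 3 ^ 3) * chi (kr * of_real (r 3))"
    and rad: "outer_f k kr d r u f = (\<i> * k * (of_real (r 1))\<^sup>2 - of_real (r 1)) * outer_u k kr d r u f"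
  shows "det (transA 3 r v vr w d) = 0"
proof -
  obtain A B U F :: "nat \<Rightarrow> complex" where A0: "A 0 = 0" and U: "U 3 = u" and F: "F 3 = f" and
    st: "\<And>i l. 1 \<le> i \<Longrightarrow> i \<le> 3 \<Longrightarrow> l < 3 \<Longrightarrow> l = i \<or> l + 1 = i \<Longrightarrow>
      A l * sj (layer_wave v vr w l * of_real (r i)) + B l * sh (layer_wave v vr w l * of_real (r i)) = U i \<and>
      layer_wave v vr w l * (of_real (r i))\<^sup>2 * (A l * sj' (layer_wave v vr w l * of_real (r i))
        + B l * sh' (layer_wave v vr w l * of_real (r i))) = (if odd l then of_real d else 1) * F i"
    by (rule outer_layers[OF v w d r rad[unfolded k_def kr_def]]) blast
  have kr: "kr \<noteq> 0" "layer_wave v vr w 3 = kr" using v w by (simp_all add: kr_def layer_wave_def)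
  show ?thesis
  proof (rule det_transA_eq_0_states[OF v w, where A = "A(3 := 1)" and B = "B(3 := 0)" and U = U and F = F])
    fix i l :: nat
    assume i: "1 \<le> i" "i \<le> 3" and l: "l = i \<or> l + 1 = i"
    show "(A(3 := 1)) l * sj (layer_wave v vr w l * of_real (r i)) + (B(3 := 0)) l * sh (layer_wave v vr w l * of_real (r i)) = U i \<and>
      layer_wave v vr w l * (of_real (r i))\<^sup>2 * ((A(3 := 1)) l * sj' (layer_wave v vr w l * of_real (r i))
        + (B(3 := 0)) l * sh' (layer_wave v vr w l * of_real (r i))) = (if odd l then of_real d else 1) * F i"
    proof (cases "l = 3")
      case True
      then have "i = 3" using i l by auto
      then show ?thesis using True kr U F u f core_flux[OF kr(1) r(1)] by simp
    next
      case False
      then have "l < 3" using i l by auto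
      then show ?thesis using st[OF i _ l] False by simp
    qed
  next
    fix i :: nat assume "1 \<le> i" "i \<le> 3"
    then have "i = 1 \<or> i = 2 \<or> i = 3" by auto
    then show "0 < r i" using r by auto
  qed (use A0 in auto)
qed

text \<open>Now the regular wave of amplitude 1 lives in a background core, and one resonator shell
  carries its state from r_4 to r_3.\<close>

lemma det_transA_4:
  assumes v: "0 < v" "0 < vr" and w: "w \<noteq> 0" and d: "d \<noteq> 0"
    and r: "0 < r 4" "r 4 < r 3" "r 3 < r 2" "r 2 < r 1"
  defines "k \<equiv> w / complex_of_real v" and "kr \<equiv> w / complex_of_real vr"
  assumes u4: "u4 = sj (k * of_real (r 4))" and f4: "f4 = k\<^sup>2 * of_real (r 4 ^ 3) * chi (k * of_real (r 4))"
    and u: "u = transfer_field kr (r 4) (r 3) u4 (of_real d * f4)"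
    and f: "of_real d * f = transfer_flux kr (r 4) (r 3) u4 (of_real d * f4)"
    and rad: "outer_f k kr d r u f = (\<i> * k * (of_real (r 1))\<^sup>2 - of_real (r 1)) * outer_u k kr d r u f"
  shows "det (transA 4 r v vr w d) = 0"
proof -
  have r3: "0 < r 3" using r by simp
  obtain A B U F :: "nat \<Rightarrow> complex" where A0: "A 0 = 0" and U: "U 3 = u" and F: "F 3 = f" and
    st: "\<And>i l. 1 \<le> i \<Longrightarrow> i \<le> 3 \<Longrightarrow> l < 3 \<Longrightarrow> l = i \<or> l + 1 = i \<Longrightarrow>
      A l * sj (layer_wave v vr w l * of_real (r i)) + B l * sh (layer_wave v vr w l * of_real (r i)) = U i \<and>
      layer_wave v vr w l * (of_real (r i))\<^sup>2 * (A l * sj' (layer_wave v vr w l * of_real (r i))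
        + B l * sh' (layer_wave v vr w l * of_real (r i))) = (if odd l then of_real d else 1) * F i"
    by (rule outer_layers[OF v w d r3 r(3,4) rad[unfolded k_def kr_def]]) blast
  have k: "k \<noteq> 0" "layer_wave v vr w 4 = k" "kr \<noteq> 0" "layer_wave v vr w 3 = kr"
    using v w by (simp_all add: k_def kr_def layer_wave_def)
  obtain A3 B3 where AB3: "A3 * sj (kr * of_real (r 4)) + B3 * sh (kr * of_real (r 4)) = u4"
    "kr * (of_real (r 4))\<^sup>2 * (A3 * sj' (kr * of_real (r 4)) + B3 * sh' (kr * of_real (r 4))) = of_real d * f4"
    "A3 * sj (kr * of_real (r 3)) + B3 * sh (kr * of_real (r 3)) = u"
    "kr * (of_real (r 3))\<^sup>2 * (A3 * sj' (kr * of_real (r 3)) + B3 * sh' (kr * of_real (r 3))) = of_real d * f"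
    unfolding u f by (rule layer_coefficients[OF k(3) r(1,2)])
  show ?thesis
  proof (rule det_transA_eq_0_states[OF v w, where A = "A(3 := A3, 4 := 1)" and B = "B(3 := B3, 4 := 0)"
        and U = "U(4 := u4)" and F = "F(4 := f4)"])
    fix i l :: nat
    assume i: "1 \<le> i" "i \<le> 4" and l: "l = i \<or> l + 1 = i"
    have "l = 4 \<and> i = 4 \<or> l = 3 \<and> i = 4 \<or> l = 3 \<and> i = 3 \<or> l < 3 \<and> i \<le> 3"
      using i l by presburger
    then consider "l = 4" "i = 4" | "l = 3" "i = 4" | "l = 3" "i = 3" | "l < 3" "i \<le> 3"
      by blast
    then show "(A(3 := A3, 4 := 1)) l * sj (layer_wave v vr w l * of_real (r i))
        + (B(3 := B3, 4 := 0)) l * sh (layer_wave v vr w l * of_real (r i)) = (U(4 := u4)) i \<and>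
      layer_wave v vr w l * (of_real (r i))\<^sup>2 * ((A(3 := A3, 4 := 1)) l * sj' (layer_wave v vr w l * of_real (r i))
        + (B(3 := B3, 4 := 0)) l * sh' (layer_wave v vr w l * of_real (r i)))
      = (if odd l then of_real d else 1) * (F(4 := f4)) i"
    proof cases
      case 4
      then show ?thesis using st[OF i(1) 4(2,1) l] by simp
    qed (use k U F u4 f4 AB3 core_flux[OF k(1) r(1)] in simp_all)
  next
    fix i :: nat assume "1 \<le> i" "i \<le> 4"
    then have "i = 1 \<or> i = 2 \<or> i = 3 \<or> i = 4" by auto
    then show "0 < r i" using r by auto
  qed (use A0 in auto)
qed

section \<open>Resonances\<close>

text \<open>With a and b as in the proof, r_1 r_2 r_3 P = a b and \<Xi> > a + b, so positivity of
  \<Delta> reduces to (a - b)^2 being nonnegative. The bound on sqrt \<Delta> makes both roots of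
  the quadratic positive.\<close>

lemma discriminant_bounds:
  fixes r1 r2 r3 E :: real
  assumes r: "0 < r3" "r3 < r2" "r2 < r1" and E: "0 < E"
  defines "\<Xi> \<equiv> r2 * r3 * (r1 ^ 3 - r2 ^ 3 + E) + r1 * (r2 - r3) * E"
    and "P \<equiv> (r1 ^ 3 - r2 ^ 3) * E * (r2 - r3)"
  defines "\<Delta> \<equiv> \<Xi> ^ 2 - 4 * r1 * r2 * r3 * P"
  shows "0 < r1 ^ 3 - r2 ^ 3" "0 < P" "0 < \<Delta>" "sqrt \<Delta> < \<Xi>"
proof -
  show D: "0 < r1 ^ 3 - r2 ^ 3" using r by (simp add: power_strict_mono)
  then show P: "0 < P" using r E by (simp add: P_def)
  define a b where "a = r2 * r3 * (r1 ^ 3 - r2 ^ 3)" and "b = r1 * (r2 - r3) * E"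
  have ab: "0 < a" "0 < b" using r E D by (auto simp: a_def b_def)
  have "4 * r1 * r2 * r3 * P = 4 * (a * b)" by (simp add: a_def b_def P_def)
  moreover have "4 * (a * b) \<le> (a + b)\<^sup>2"
    using zero_le_power2[of "a - b"] by (simp add: power2_eq_square algebra_simps)
  moreover have lt: "a + b < \<Xi>" using r E by (simp add: a_def b_def \<Xi>_def algebra_simps)
  moreover have "(a + b)\<^sup>2 < \<Xi>\<^sup>2" using lt ab by (intro power_strict_mono) auto
  ultimately show "0 < \<Delta>" by (simp add: \<Delta>_def)
  have "\<Delta> < \<Xi>\<^sup>2" using P r by (simp add: \<Delta>_def)
  then show "sqrt \<Delta> < \<Xi>" using lt ab by (intro real_less_lsqrt) auto
qed

text \<open>\<open>E\<close> is all that remains of the structure inside r_3, and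
  \<open>zero\<close> abstracts the vanishing of the determinant at a given frequency and contrast.
  The sign \<open>s\<close> selects the smaller (-1) or larger (1) root of the quadratic.\<close>

lemma layer_resonance:
  fixes r :: "nat \<Rightarrow> real" and v vr E s :: real and zero :: "complex \<Rightarrow> real \<Rightarrow> bool"
  assumes v: "0 < v" "0 < vr" and r: "0 < r 3" "r 3 < r 2" "r 2 < r 1" and E: "0 < E"
    and s: "s = 1 \<or> s = - 1"
    and u: "expands u (\<lambda>z. 1)" and f: "expands f (\<lambda>z. - (z\<^sup>2 * of_real (E / 3)))"
    and zero: "\<And>z e. z \<noteq> 0 \<Longrightarrow> 0 < e \<Longrightarrow> e < 1 \<Longrightarrow>
      outer_f (of_real e * z * of_real (vr / v)) (of_real e * z) (e\<^sup>2) r (u z e) (f z e)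
      = (\<i> * (of_real e * z * of_real (vr / v)) * (of_real (r 1))\<^sup>2 - of_real (r 1))
        * outer_u (of_real e * z * of_real (vr / v)) (of_real e * z) (e\<^sup>2) r (u z e) (f z e)
      \<Longrightarrow> zero (of_real vr * (of_real e * z)) (e\<^sup>2)"
  defines "\<Xi> \<equiv> r 2 * r 3 * (r 1 ^ 3 - r 2 ^ 3 + E) + r 1 * (r 2 - r 3) * E"
    and "P \<equiv> (r 1 ^ 3 - r 2 ^ 3) * E * (r 2 - r 3)"
  defines "\<Delta> \<equiv> \<Xi> ^ 2 - 4 * r 1 * r 2 * r 3 * P"
  defines "a \<equiv> vr * sqrt ((3 * \<Xi> + s * (3 * sqrt \<Delta>)) / (2 * P))"
    and "b \<equiv> s * (3 * (\<Xi> + s * sqrt \<Delta>) - 6 * r 2 * r 3 * (r 1 ^ 3 - r 2 ^ 3))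
      / (4 * (v / vr) * (r 1 ^ 3 - r 2 ^ 3) * sqrt \<Delta>) * r 1 ^ 2 * vr"
  obtains \<delta>0 \<omega> where "0 < \<delta>0" "continuous_on {0<..<\<delta>0} \<omega>"
    "\<And>\<delta>. 0 < \<delta> \<Longrightarrow> \<delta> < \<delta>0 \<Longrightarrow> zero (\<omega> \<delta>) \<delta> \<and> Re (\<omega> \<delta>) > 0"
    "(\<lambda>\<delta>. \<omega> \<delta> - (complex_of_real (a * sqrt \<delta>) - \<i> * complex_of_real (b * \<delta>)))
       \<in> O[at_right 0](\<lambda>\<delta>. complex_of_real (\<delta> powr (3/2)))"
proof -
  define c where "c = vr / v"
  define D where "D = r 1 ^ 3 - r 2 ^ 3"
  define S where "S = sqrt \<Delta>"
  \<comment> \<open>Crossing the gap from r_3 to r_2 with flux - z^2 E / 3 changes the field by -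
    \<mu> z^2.\<close>
  define \<mu> where "\<mu> = E * (r 2 - r 3) / (3 * r 2 * r 3)"
  note bounds = discriminant_bounds[OF r E, folded \<Xi>_def P_def, folded \<Delta>_def, folded D_def S_def]
  have pos: "0 < r 2" "0 < r 1" "0 < S" using r bounds(3) by (auto simp: S_def)
  have S2: "S\<^sup>2 = \<Delta>" using bounds(3) by (simp add: S_def)
  have ss: "s * s = 1" "s \<noteq> 0" using s by auto
  define X where "X = (3 * \<Xi> + s * (3 * S)) / (2 * P)"
  have PX: "2 * P * X = 3 * \<Xi> + s * (3 * S)" using bounds(2) by (simp add: X_def)
  have X0: "0 < X" unfolding X_def using bounds(2,4) s pos(3) by (intro divide_pos_pos) auto
  define x where "x = sqrt X"
  have x: "0 < x" "x\<^sup>2 = X" using X0 by (simp_all add: x_def)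
  \<comment> \<open>The leading-order condition W + r_1 U = 0 reads r_1 - \<alpha> X + \<beta> X^2 =
    0 in X = z^2.\<close>
  define \<alpha> where "\<alpha> = E / 3 + D / 3 + r 1 * \<mu>"
  define \<beta> where "\<beta> = D / 3 * \<mu>"
  have \<alpha>: "3 * r 2 * r 3 * \<alpha> = \<Xi>" and \<beta>: "9 * r 2 * r 3 * \<beta> = P" and \<mu>: "3 * r 2 * r 3 * (D * \<mu>) = P"
    using pos r(1) by (simp_all add: \<alpha>_def \<beta>_def \<mu>_def \<Xi>_def P_def D_def field_simps)
  have root: "r 1 - \<alpha> * X + \<beta> * X\<^sup>2 = 0"
  proof -
    have "(2 * P * X - 3 * \<Xi>)\<^sup>2 = 9 * \<Delta>"
      unfolding PX using ss(1) S2 by (simp add: power2_eq_square algebra_simps)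
    then have "4 * P * (P * X\<^sup>2 - 3 * \<Xi> * X + 9 * r 1 * r 2 * r 3) = 0"
      by (simp add: \<Delta>_def power2_eq_square algebra_simps)
    then have "P * X\<^sup>2 - 3 * \<Xi> * X + 9 * r 1 * r 2 * r 3 = 0" using bounds(2) by simp
    then have "9 * r 2 * r 3 * (r 1 - \<alpha> * X + \<beta> * X\<^sup>2) = 0"
      unfolding \<alpha>[symmetric] \<beta>[symmetric] by (simp add: algebra_simps)
    then show ?thesis using pos r(1) by simp
  qed
  \<comment> \<open>The derivative of the quadratic at its root X, so that Q' at x is 2 x q. The
    discriminant gives its value, which is nonzero; hence the root is simple.\<close>
  define q where "q = 2 * \<beta> * X - \<alpha>"
  have q: "3 * r 2 * r 3 * q = s * S"
  proof -
    have "9 * r 2 * r 3 * q = 2 * P * X - 3 * \<Xi>"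
      unfolding q_def \<alpha>[symmetric] \<beta>[symmetric] by (simp add: algebra_simps)
    then show ?thesis unfolding PX by (simp add: mult_ac)
  qed
  have q0: "q \<noteq> 0" using q ss(2) pos(3) by auto
  \<comment> \<open>Chosen so that the correction -R/Q' at x equals -\<i> b'.\<close>
  define b' where "b' = - (c * r 1 ^ 2 * (1 - \<mu> * X) / (2 * q))"
  have b: "b = vr * b'"
  proof -
    have "2 * (r 2 * r 3 * D) * (1 - \<mu> * X) = 2 * (r 2 * r 3 * D) - (\<Xi> + s * S)"
      using PX unfolding \<mu>[symmetric] by (simp add: algebra_simps)
    then have 1: "1 - \<mu> * X = (2 * (r 2 * r 3 * D) - (\<Xi> + s * S)) / (2 * (r 2 * r 3 * D))"
      using pos r(1) bounds(1) by (simp add: field_simps)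
    have "q * (s * (3 * r 2 * r 3) / S) = s * (3 * r 2 * r 3 * q) / S" by simp
    also have "\<dots> = 1" unfolding q using ss pos(3) by simp
    finally have 2: "inverse q = s * (3 * r 2 * r 3) / S" by (rule inverse_unique)
    have 3: "b' = - (c * r 1 ^ 2 * ((2 * (r 2 * r 3 * D) - (\<Xi> + s * S)) / (2 * (r 2 * r 3 * D))) / 2
        * (s * (3 * r 2 * r 3) / S))"
      unfolding b'_def 1[symmetric] 2[symmetric] by (simp add: field_simps)
    show ?thesis
      unfolding b_def S_def[symmetric] D_def[symmetric] 3 c_def using pos r(1) bounds(1) v
      by (simp add: field_simps)
  qed
  define U where "U z = 1 - of_real \<mu> * z\<^sup>2" for z :: complex
  define W where "W z = - (z\<^sup>2 * of_real (E / 3)) - z\<^sup>2 * of_real (D / 3) * U z" for z :: complex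
  have U: "1 + of_real ((r 2 - r 3) / (r 3 * r 2)) * (- (z\<^sup>2 * of_real (E / 3))) = U z" for z :: complex
    using pos r(1) by (simp add: U_def \<mu>_def field_simps)
  let ?u = "\<lambda>z e. outer_u (of_real e * z * of_real c) (of_real e * z) (e\<^sup>2) r (u z e) (f z e)"
  let ?f = "\<lambda>z e. outer_f (of_real e * z * of_real c) (of_real e * z) (e\<^sup>2) r (u z e) (f z e)"
  note bg = expands_transfer_background[OF r(1,2) u f, where c = "of_real c"]
  have eu: "expands ?u U" and ef: "expands ?f W"
    using expands_transfer_resonator[OF pos(1) r(3) bg, unfolded U]
    by (simp_all add: outer_u_def[abs_def] outer_f_def[abs_def] W_def[abs_def] D_def)
  obtain gu where gu: "lip_family (\<lambda>z e. U z)" "lip_family gu"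
    "\<forall>z e. 0 < e \<longrightarrow> e < 1 \<longrightarrow> ?u z e = U z + (of_real e)\<^sup>2 * gu z e"
    using eu unfolding expands_def by blast
  obtain gf where gf: "lip_family gf"
    "\<forall>z e. 0 < e \<longrightarrow> e < 1 \<longrightarrow> ?f z e = W z + (of_real e)\<^sup>2 * gf z e"
    using ef unfolding expands_def by blast
  \<comment> \<open>With k = e z c, the term - \<i> k r_1^2 times the field is the only one odd in
    e: applied to \<open>U\<close> it gives \<open>R\<close>, applied to the remainder
    \<open>gu\<close> it goes into \<open>g\<close>.\<close>
  define R where "R z = (- \<i> * of_real (c * r 1 ^ 2)) * z * U z" for z
  define g where "g z e = gf z e + (of_real (r 1) + (- \<i> * of_real (c * r 1 ^ 2)) * of_real e * z) * gu z e" for z e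
  define Q where "Q z = of_real (r 1) - of_real \<alpha> * z\<^sup>2 + of_real \<beta> * z ^ 4" for z :: complex
  define Q' where "Q' z = of_real (- 2 * \<alpha>) * z + of_real (4 * \<beta>) * z ^ 3" for z :: complex
  have QW: "Q z = W z + of_real (r 1) * U z" for z
    by (simp add: Q_def W_def U_def \<alpha>_def \<beta>_def field_simps eval_nat_numeral)
  have G: "?f z e + (of_real (r 1) - \<i> * (of_real e * z * of_real c) * (of_real (r 1))\<^sup>2) * ?u z e
      = Q z + of_real e * R z + (of_real e)\<^sup>2 * g z e" if "0 < e" "e < 1" for z e
    unfolding gu(3)[rule_format, OF that] gf(2)[rule_format, OF that] QW R_def g_def
    by (simp add: algebra_simps)
  have dQ: "(Q has_field_derivative Q' z) (at z)" for z
    unfolding Q_def[abs_def] Q'_def by (auto intro!: derivative_eq_intros)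
  have lips: "lip_family (\<lambda>z e. Q' z)" "lip_family (\<lambda>z e. R z)" "lip_family g"
    unfolding Q'_def R_def g_def
    by (intro lip_family_add lip_family_mult lip_family_power lip_family_const lip_family_var
        lip_family_eps gu(1,2) gf(1))+
  have Qx: "Q (of_real x) = 0"
  proof -
    have "Q (of_real x) = of_real (r 1 - \<alpha> * x\<^sup>2 + \<beta> * (x\<^sup>2)\<^sup>2)"
      by (simp add: Q_def power_mult[symmetric])
    then show ?thesis unfolding x(2) root by simp
  qed
  have Q'x: "Q' (of_real x) = of_real (2 * x * q)"
    by (simp add: Q'_def q_def x(2)[symmetric] eval_nat_numeral algebra_simps)
  have Q'0: "Q' (of_real x) \<noteq> 0" unfolding Q'x using x q0 by simp
  have z1: "- R (of_real x) / Q' (of_real x) = - \<i> * of_real b'"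
  proof -
    have 1: "R (of_real x) = - \<i> * of_real (c * r 1 ^ 2 * x * (1 - \<mu> * X))"
      by (simp add: R_def U_def x(2)[symmetric])
    have 2: "c * r 1 ^ 2 * x * (1 - \<mu> * X) = - b' * (2 * x * q)"
      using q0 by (simp add: b'_def)
    have "R (of_real x) = \<i> * of_real b' * of_real (2 * x * q)"
      unfolding 1 2 by simp
    then show ?thesis using Q'0 unfolding Q'x by simp
  qed
  obtain e0 C Z where Z: "0 < e0" "e0 \<le> 1" "0 \<le> C" "continuous_on {0<..<e0} Z"
    "\<And>e. 0 < e \<Longrightarrow> e < e0 \<Longrightarrow> Q (Z e) + of_real e * R (Z e) + (of_real e)\<^sup>2 * g (Z e) e = 0"
    "\<And>e. 0 < e \<Longrightarrow> e < e0 \<Longrightarrow> norm (Z e - (of_real x + of_real e * (- \<i> * of_real b'))) \<le> C * e\<^sup>2"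
    using perturbed_simple_root[OF dQ lips Qx Q'0, unfolded z1] by blast
  define \<omega> where "\<omega> \<delta> = of_real vr * (of_real (sqrt \<delta>) * Z (sqrt \<delta>))" for \<delta>
  obtain \<delta>0 where \<delta>0: "0 < \<delta>0" "continuous_on {0<..<\<delta>0} \<omega>"
    "\<And>\<delta>. 0 < \<delta> \<Longrightarrow> \<delta> < \<delta>0 \<Longrightarrow> sqrt \<delta> < e0 \<and> Re (Z (sqrt \<delta>)) > 0 \<and> Re (\<omega> \<delta>) > 0"
    "(\<lambda>\<delta>. \<omega> \<delta> - (of_real (vr * x * sqrt \<delta>) - \<i> * of_real (vr * b' * \<delta>)))
       \<in> O[at_right 0](\<lambda>\<delta>. complex_of_real (\<delta> powr (3/2)))"
    using continuous_scaled_root[OF Z(4,6) x(1) Z(1,2,3) v(2), folded \<omega>_def] by blast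
  have ax: "a = vr * x" by (simp add: a_def x_def X_def S_def)
  have "zero (\<omega> \<delta>) \<delta> \<and> Re (\<omega> \<delta>) > 0" if \<delta>: "0 < \<delta>" "\<delta> < \<delta>0" for \<delta>
  proof -
    define e where "e = sqrt \<delta>"
    have e': "0 < e" "e < e0" "e\<^sup>2 = \<delta>" using \<delta>0(3)[OF \<delta>] \<delta> by (simp_all add: e_def)
    have "e < 1" using e'(2) Z(2) by linarith
    note e = e'(1,2) this e'(3)
    have "Z e \<noteq> 0" using \<delta>0(3)[OF \<delta>] by (auto simp: e_def)
    moreover have "?f (Z e) e = (\<i> * (of_real e * Z e * of_real c) * (of_real (r 1))\<^sup>2 - of_real (r 1)) * ?u (Z e) e"
      using G[OF e(1,3), of "Z e"] Z(5)[OF e(1,2)] by (simp add: algebra_simps)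
    ultimately have "zero (of_real vr * (of_real e * Z e)) (e\<^sup>2)"
      using e unfolding c_def by (intro zero)
    then show ?thesis using \<delta>0(3)[OF \<delta>] e(4) by (simp add: \<omega>_def e_def)
  qed
  then show thesis by (rule that[OF \<delta>0(1,2) _ \<delta>0(4)[folded ax b]])
qed

text \<open>The coefficients enter through equations, so each number of layers can supply its own
  form of them and prove the identities separately.\<close>

lemma layer_resonances:
  fixes r :: "nat \<Rightarrow> real" and v vr E :: real and zero :: "complex \<Rightarrow> real \<Rightarrow> bool"
  assumes v: "0 < v" "0 < vr" and r: "0 < r 3" "r 3 < r 2" "r 2 < r 1" and E: "0 < E"
    and u: "expands u (\<lambda>z. 1)" and f: "expands f (\<lambda>z. - (z\<^sup>2 * of_real (E / 3)))"
    and zero: "\<And>z e. z \<noteq> 0 \<Longrightarrow> 0 < e \<Longrightarrow> e < 1 \<Longrightarrow>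
      outer_f (of_real e * z * of_real (vr / v)) (of_real e * z) (e\<^sup>2) r (u z e) (f z e)
      = (\<i> * (of_real e * z * of_real (vr / v)) * (of_real (r 1))\<^sup>2 - of_real (r 1))
        * outer_u (of_real e * z * of_real (vr / v)) (of_real e * z) (e\<^sup>2) r (u z e) (f z e)
      \<Longrightarrow> zero (of_real vr * (of_real e * z)) (e\<^sup>2)"
  defines "\<Xi> \<equiv> r 2 * r 3 * (r 1 ^ 3 - r 2 ^ 3 + E) + r 1 * (r 2 - r 3) * E"
    and "P \<equiv> (r 1 ^ 3 - r 2 ^ 3) * E * (r 2 - r 3)"
  defines "\<Delta> \<equiv> \<Xi> ^ 2 - 4 * r 1 * r 2 * r 3 * P"
  assumes a1: "a1 = vr * sqrt ((3 * \<Xi> - 3 * sqrt \<Delta>) / (2 * P))"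
    and b1: "b1 = (3 * (- \<Xi> + sqrt \<Delta>) + 6 * r 2 * r 3 * (r 1 ^ 3 - r 2 ^ 3))
      / (4 * (v / vr) * (r 1 ^ 3 - r 2 ^ 3) * sqrt \<Delta>) * r 1 ^ 2 * vr"
    and a2: "a2 = vr * sqrt ((3 * \<Xi> + 3 * sqrt \<Delta>) / (2 * P))"
    and b2: "b2 = (3 * (\<Xi> + sqrt \<Delta>) - 6 * r 2 * r 3 * (r 1 ^ 3 - r 2 ^ 3))
      / (4 * (v / vr) * (r 1 ^ 3 - r 2 ^ 3) * sqrt \<Delta>) * r 1 ^ 2 * vr"
  shows "\<exists>\<delta>0 > 0. \<exists>\<omega>1 \<omega>2 :: real \<Rightarrow> complex.
            continuous_on {0<..<\<delta>0} \<omega>1 \<and> continuous_on {0<..<\<delta>0} \<omega>2 \<and>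
            (\<forall>\<delta> \<in> {0<..<\<delta>0}. zero (\<omega>1 \<delta>) \<delta> \<and> Re (\<omega>1 \<delta>) > 0 \<and> zero (\<omega>2 \<delta>) \<delta> \<and> Re (\<omega>2 \<delta>) > 0) \<and>
            (\<lambda>\<delta>. \<omega>1 \<delta> - (complex_of_real (a1 * sqrt \<delta>) - \<i> * complex_of_real (b1 * \<delta>)))
               \<in> O[at_right 0](\<lambda>\<delta>. complex_of_real (\<delta> powr (3/2))) \<and>
            (\<lambda>\<delta>. \<omega>2 \<delta> - (complex_of_real (a2 * sqrt \<delta>) - \<i> * complex_of_real (b2 * \<delta>)))
               \<in> O[at_right 0](\<lambda>\<delta>. complex_of_real (\<delta> powr (3/2)))"
proof -
  note res = layer_resonance[where zero = zero, OF v r E _ u f zero, folded \<Xi>_def P_def, folded \<Delta>_def]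
  have a1': "vr * sqrt ((3 * \<Xi> + (- 1) * (3 * sqrt \<Delta>)) / (2 * P)) = a1" by (simp add: a1)
  have b1': "(- 1) * (3 * (\<Xi> + (- 1) * sqrt \<Delta>) - 6 * r 2 * r 3 * (r 1 ^ 3 - r 2 ^ 3))
      / (4 * (v / vr) * (r 1 ^ 3 - r 2 ^ 3) * sqrt \<Delta>) * r 1 ^ 2 * vr = b1"
    unfolding b1 by (simp add: algebra_simps)
  have a2': "vr * sqrt ((3 * \<Xi> + 1 * (3 * sqrt \<Delta>)) / (2 * P)) = a2" by (simp add: a2)
  have b2': "1 * (3 * (\<Xi> + 1 * sqrt \<Delta>) - 6 * r 2 * r 3 * (r 1 ^ 3 - r 2 ^ 3))
      / (4 * (v / vr) * (r 1 ^ 3 - r 2 ^ 3) * sqrt \<Delta>) * r 1 ^ 2 * vr = b2"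
    unfolding b2 by simp
  obtain d1 \<omega>1 where 1: "0 < d1" "continuous_on {0<..<d1} \<omega>1"
    "\<And>\<delta>. 0 < \<delta> \<Longrightarrow> \<delta> < d1 \<Longrightarrow> zero (\<omega>1 \<delta>) \<delta> \<and> Re (\<omega>1 \<delta>) > 0"
    "(\<lambda>\<delta>. \<omega>1 \<delta> - (complex_of_real (a1 * sqrt \<delta>) - \<i> * complex_of_real (b1 * \<delta>)))
       \<in> O[at_right 0](\<lambda>\<delta>. complex_of_real (\<delta> powr (3/2)))"
    using res[where s = "- 1", unfolded a1' b1'] by blast
  obtain d2 \<omega>2 where 2: "0 < d2" "continuous_on {0<..<d2} \<omega>2"
    "\<And>\<delta>. 0 < \<delta> \<Longrightarrow> \<delta> < d2 \<Longrightarrow> zero (\<omega>2 \<delta>) \<delta> \<and> Re (\<omega>2 \<delta>) > 0"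
    "(\<lambda>\<delta>. \<omega>2 \<delta> - (complex_of_real (a2 * sqrt \<delta>) - \<i> * complex_of_real (b2 * \<delta>)))
       \<in> O[at_right 0](\<lambda>\<delta>. complex_of_real (\<delta> powr (3/2)))"
    using res[where s = 1, unfolded a2' b2'] by blast
  have "{0<..<min d1 d2} \<subseteq> {0<..<d1}" "{0<..<min d1 d2} \<subseteq> {0<..<d2}" by auto
  then have "continuous_on {0<..<min d1 d2} \<omega>1" "continuous_on {0<..<min d1 d2} \<omega>2"
    using 1(2) 2(2) continuous_on_subset by blast+
  then show ?thesis
    using 1 2 by (intro exI[of _ "min d1 d2"] exI[of _ \<omega>1] exI[of _ \<omega>2] conjI) auto
qed

theorem mainTheorem4:
  fixes r :: "nat \<Rightarrow> real" and v vr :: real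
  assumes hv: "v > 0" and hvr: "vr > 0"
  shows
   "(r 1 > r 2 \<and> r 2 > r 3 \<and> r 3 > 0 \<longrightarrow>
     (let \<tau> = v / vr;
          \<Xi> = r 2 * (r 1 ^ 3 - r 2 ^ 3 + r 3 ^ 3) + r 1 * r 3 ^ 2 * (r 2 - r 3);
          \<Delta> = \<Xi> ^ 2 - 4 * r 1 * r 2 * r 3 ^ 2 * (r 2 - r 3) * (r 1 ^ 3 - r 2 ^ 3);
          a1 = vr * sqrt ((3 * \<Xi> - 3 * sqrt \<Delta>) / (2 * (r 2 - r 3) * (r 1 ^ 3 - r 2 ^ 3) * r 3 ^ 2));
          b1 = (3 * (- \<Xi> + sqrt \<Delta>) + 6 * r 2 * (r 1 ^ 3 - r 2 ^ 3))
                 / (4 * \<tau> * (r 1 ^ 3 - r 2 ^ 3) * sqrt \<Delta>) * r 1 ^ 2 * vr;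
          a2 = vr * sqrt ((3 * \<Xi> + 3 * sqrt \<Delta>) / (2 * (r 2 - r 3) * (r 1 ^ 3 - r 2 ^ 3) * r 3 ^ 2));
          b2 = (3 * (\<Xi> + sqrt \<Delta>) - 6 * r 2 * (r 1 ^ 3 - r 2 ^ 3))
                 / (4 * \<tau> * (r 1 ^ 3 - r 2 ^ 3) * sqrt \<Delta>) * r 1 ^ 2 * vr
      in \<Delta> > 0 \<and>
         (\<exists>\<delta>0 > 0. \<exists>\<omega>1 \<omega>2 :: real \<Rightarrow> complex.
            continuous_on {0<..<\<delta>0} \<omega>1 \<and> continuous_on {0<..<\<delta>0} \<omega>2 \<and>
            (\<forall>\<delta> \<in> {0<..<\<delta>0}.
               det (transA 3 r v vr (\<omega>1 \<delta>) \<delta>) = 0 \<and> Re (\<omega>1 \<delta>) > 0 \<and>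
               det (transA 3 r v vr (\<omega>2 \<delta>) \<delta>) = 0 \<and> Re (\<omega>2 \<delta>) > 0) \<and>
            (\<lambda>\<delta>. \<omega>1 \<delta> - (complex_of_real (a1 * sqrt \<delta>) - \<i> * complex_of_real (b1 * \<delta>)))
               \<in> O[at_right 0](\<lambda>\<delta>. complex_of_real (\<delta> powr (3/2))) \<and>
            (\<lambda>\<delta>. \<omega>2 \<delta> - (complex_of_real (a2 * sqrt \<delta>) - \<i> * complex_of_real (b2 * \<delta>)))
               \<in> O[at_right 0](\<lambda>\<delta>. complex_of_real (\<delta> powr (3/2))))))
    \<and>
    (r 1 > r 2 \<and> r 2 > r 3 \<and> r 3 > r 4 \<and> r 4 > 0 \<longrightarrow>
     (let \<tau> = v / vr;
          \<Xi> = r 2 * r 3 * (r 1 ^ 3 - r 2 ^ 3 + r 3 ^ 3 - r 4 ^ 3) + r 1 * (r 2 - r 3) * (r 3 ^ 3 - r 4 ^ 3);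
          P = (r 1 ^ 3 - r 2 ^ 3) * (r 3 ^ 3 - r 4 ^ 3) * (r 2 - r 3);
          \<Delta> = \<Xi> ^ 2 - 4 * r 1 * r 2 * r 3 * P;
          a1 = vr * sqrt ((3 * \<Xi> - 3 * sqrt \<Delta>) / (2 * P));
          b1 = (3 * (- \<Xi> + sqrt \<Delta>) + 6 * r 2 * r 3 * (r 1 ^ 3 - r 2 ^ 3))
                 / (4 * \<tau> * (r 1 ^ 3 - r 2 ^ 3) * sqrt \<Delta>) * vr * r 1 ^ 2;
          a2 = vr * sqrt ((3 * \<Xi> + 3 * sqrt \<Delta>) / (2 * P));
          b2 = (3 * (\<Xi> + sqrt \<Delta>) - 6 * r 2 * r 3 * (r 1 ^ 3 - r 2 ^ 3))
                 / (4 * \<tau> * (r 1 ^ 3 - r 2 ^ 3) * sqrt \<Delta>) * vr * r 1 ^ 2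
      in \<Delta> > 0 \<and>
         (\<exists>\<delta>0 > 0. \<exists>\<omega>1 \<omega>2 :: real \<Rightarrow> complex.
            continuous_on {0<..<\<delta>0} \<omega>1 \<and> continuous_on {0<..<\<delta>0} \<omega>2 \<and>
            (\<forall>\<delta> \<in> {0<..<\<delta>0}.
               det (transA 4 r v vr (\<omega>1 \<delta>) \<delta>) = 0 \<and> Re (\<omega>1 \<delta>) > 0 \<and>
               det (transA 4 r v vr (\<omega>2 \<delta>) \<delta>) = 0 \<and> Re (\<omega>2 \<delta>) > 0) \<and>
            (\<lambda>\<delta>. \<omega>1 \<delta> - (complex_of_real (a1 * sqrt \<delta>) - \<i> * complex_of_real (b1 * \<delta>)))
               \<in> O[at_right 0](\<lambda>\<delta>. complex_of_real (\<delta> powr (3/2))) \<and>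
            (\<lambda>\<delta>. \<omega>2 \<delta> - (complex_of_real (a2 * sqrt \<delta>) - \<i> * complex_of_real (b2 * \<delta>)))
               \<in> O[at_right 0](\<lambda>\<delta>. complex_of_real (\<delta> powr (3/2))))))"
proof (intro conjI impI)
  assume r: "r 1 > r 2 \<and> r 2 > r 3 \<and> r 3 > 0"
  define \<Xi> where "\<Xi> = r 2 * (r 1 ^ 3 - r 2 ^ 3 + r 3 ^ 3) + r 1 * r 3 ^ 2 * (r 2 - r 3)"
  define D where "D = r 1 ^ 3 - r 2 ^ 3"
  define \<Delta> where "\<Delta> = \<Xi> ^ 2 - 4 * r 1 * r 2 * r 3 ^ 2 * (r 2 - r 3) * D"
  have r': "0 < r 3" "r 3 < r 2" "r 2 < r 1" "0 < r 3 ^ 3" using r by auto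
  \<comment> \<open>The three-layer quantities are those of four layers at \<open>r\<^sub>4 = 0\<close>, up to powers of \<open>r\<^sub>3\<close>.\<close>
  have \<Xi>: "r 2 * r 3 * (r 1 ^ 3 - r 2 ^ 3 + r 3 ^ 3) + r 1 * (r 2 - r 3) * r 3 ^ 3 = r 3 * \<Xi>"
    by (simp add: \<Xi>_def power2_eq_square power3_eq_cube algebra_simps)
  have \<Delta>: "(r 3 * \<Xi>) ^ 2 - 4 * r 1 * r 2 * r 3 * ((r 1 ^ 3 - r 2 ^ 3) * r 3 ^ 3 * (r 2 - r 3)) = r 3 ^ 2 * \<Delta>"
    unfolding \<Delta>_def D_def by (simp add: power2_eq_square power3_eq_cube algebra_simps)
  note bounds = discriminant_bounds[OF r', unfolded \<Xi>, unfolded \<Delta>]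
  have pos: "0 < \<Delta>" "0 < D" using bounds(1,3) r'(1) by (simp_all add: zero_less_mult_iff D_def)
  have sqrt: "sqrt (r 3 ^ 2 * \<Delta>) = r 3 * sqrt \<Delta>" using r'(1) by (simp add: real_sqrt_mult)
  have cancel_a: "(3 * (r 3 * \<Xi>) + t * (r 3 * sqrt \<Delta>)) / (2 * (D * r 3 ^ 3 * (r 2 - r 3)))
      = (3 * \<Xi> + t * sqrt \<Delta>) / (2 * (r 2 - r 3) * D * r 3 ^ 2)" for t
  proof -
    have "(3 * (r 3 * \<Xi>) + t * (r 3 * sqrt \<Delta>)) / (2 * (D * r 3 ^ 3 * (r 2 - r 3)))
        = (r 3 * (3 * \<Xi> + t * sqrt \<Delta>)) / (r 3 * (2 * (r 2 - r 3) * D * r 3 ^ 2))"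
      by (simp add: algebra_simps power2_eq_square power3_eq_cube)
    then show ?thesis using r'(1) by simp
  qed
  have cancel_b: "r 3 * n / (4 * (v / vr) * D * (r 3 * sqrt \<Delta>)) = n / (4 * (v / vr) * D * sqrt \<Delta>)" for n
    using r'(1) by simp
  \<comment> \<open>The inner flux is that of the resonator core, k_r^2 r_3^3 \<open>chi\<close>,
    divided by \<delta> = e^2; as k_r = e z, no power of e is left in front.\<close>
  note res = layer_resonances[where r = r and zero = "\<lambda>w d. det (transA 3 r v vr w d) = 0" and E = "r 3 ^ 3"
      and u = "\<lambda>z e. sj (of_real e * z * of_real (r 3))"
      and f = "\<lambda>z e. z * z * of_real (r 3 ^ 3) * chi (of_real e * z * of_real (r 3))",
      OF hv hvr r', unfolded \<Xi>, unfolded \<Delta>, unfolded sqrt, folded D_def]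
  show "let \<tau> = v / vr;
          \<Xi> = r 2 * (r 1 ^ 3 - r 2 ^ 3 + r 3 ^ 3) + r 1 * r 3 ^ 2 * (r 2 - r 3);
          \<Delta> = \<Xi> ^ 2 - 4 * r 1 * r 2 * r 3 ^ 2 * (r 2 - r 3) * (r 1 ^ 3 - r 2 ^ 3);
          a1 = vr * sqrt ((3 * \<Xi> - 3 * sqrt \<Delta>) / (2 * (r 2 - r 3) * (r 1 ^ 3 - r 2 ^ 3) * r 3 ^ 2));
          b1 = (3 * (- \<Xi> + sqrt \<Delta>) + 6 * r 2 * (r 1 ^ 3 - r 2 ^ 3))
                 / (4 * \<tau> * (r 1 ^ 3 - r 2 ^ 3) * sqrt \<Delta>) * r 1 ^ 2 * vr;
          a2 = vr * sqrt ((3 * \<Xi> + 3 * sqrt \<Delta>) / (2 * (r 2 - r 3) * (r 1 ^ 3 - r 2 ^ 3) * r 3 ^ 2));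
          b2 = (3 * (\<Xi> + sqrt \<Delta>) - 6 * r 2 * (r 1 ^ 3 - r 2 ^ 3))
                 / (4 * \<tau> * (r 1 ^ 3 - r 2 ^ 3) * sqrt \<Delta>) * r 1 ^ 2 * vr
      in \<Delta> > 0 \<and>
         (\<exists>\<delta>0 > 0. \<exists>\<omega>1 \<omega>2 :: real \<Rightarrow> complex.
            continuous_on {0<..<\<delta>0} \<omega>1 \<and> continuous_on {0<..<\<delta>0} \<omega>2 \<and>
            (\<forall>\<delta> \<in> {0<..<\<delta>0}.
               det (transA 3 r v vr (\<omega>1 \<delta>) \<delta>) = 0 \<and> Re (\<omega>1 \<delta>) > 0 \<and>
               det (transA 3 r v vr (\<omega>2 \<delta>) \<delta>) = 0 \<and> Re (\<omega>2 \<delta>) > 0) \<and>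
            (\<lambda>\<delta>. \<omega>1 \<delta> - (complex_of_real (a1 * sqrt \<delta>) - \<i> * complex_of_real (b1 * \<delta>)))
               \<in> O[at_right 0](\<lambda>\<delta>. complex_of_real (\<delta> powr (3/2))) \<and>
            (\<lambda>\<delta>. \<omega>2 \<delta> - (complex_of_real (a2 * sqrt \<delta>) - \<i> * complex_of_real (b2 * \<delta>)))
               \<in> O[at_right 0](\<lambda>\<delta>. complex_of_real (\<delta> powr (3/2))))"
    unfolding Let_def D_def[symmetric] \<Xi>_def[symmetric, folded D_def] \<Delta>_def[symmetric]
  proof (intro conjI pos(1) res)
    show "expands (\<lambda>z e. sj (of_real e * z * of_real (r 3))) (\<lambda>z. 1)" by (rule expands_trig)
    show "expands (\<lambda>z e. z * z * of_real (r 3 ^ 3) * chi (of_real e * z * of_real (r 3)))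
        (\<lambda>z. - (z\<^sup>2 * of_real (r 3 ^ 3 / 3)))"
    proof (rule expands_cong)
      show "expands (\<lambda>z e. z * z * of_real (r 3 ^ 3) * chi (of_real e * z * of_real (r 3)))
          (\<lambda>z. z * z * of_real (r 3 ^ 3) * (- 1 / 3))"
        by (intro expands_mult expands_var expands_const expands_trig)
    qed (simp_all add: power2_eq_square)
    show "vr * sqrt ((3 * \<Xi> - 3 * sqrt \<Delta>) / (2 * (r 2 - r 3) * D * r 3 ^ 2))
        = vr * sqrt ((3 * (r 3 * \<Xi>) - 3 * (r 3 * sqrt \<Delta>)) / (2 * (D * r 3 ^ 3 * (r 2 - r 3))))"
      using cancel_a[of "- 3"] by simp
    show "vr * sqrt ((3 * \<Xi> + 3 * sqrt \<Delta>) / (2 * (r 2 - r 3) * D * r 3 ^ 2))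
        = vr * sqrt ((3 * (r 3 * \<Xi>) + 3 * (r 3 * sqrt \<Delta>)) / (2 * (D * r 3 ^ 3 * (r 2 - r 3))))"
      using cancel_a[of 3] by simp
    show "(3 * (- \<Xi> + sqrt \<Delta>) + 6 * r 2 * D) / (4 * (v / vr) * D * sqrt \<Delta>) * r 1 ^ 2 * vr
        = (3 * (- (r 3 * \<Xi>) + r 3 * sqrt \<Delta>) + 6 * r 2 * r 3 * D)
          / (4 * (v / vr) * D * (r 3 * sqrt \<Delta>)) * r 1 ^ 2 * vr"
      unfolding cancel_b[symmetric] by (simp add: algebra_simps)
    show "(3 * (\<Xi> + sqrt \<Delta>) - 6 * r 2 * D) / (4 * (v / vr) * D * sqrt \<Delta>) * r 1 ^ 2 * vr
        = (3 * (r 3 * \<Xi> + r 3 * sqrt \<Delta>) - 6 * r 2 * r 3 * D)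
          / (4 * (v / vr) * D * (r 3 * sqrt \<Delta>)) * r 1 ^ 2 * vr"
      unfolding cancel_b[symmetric] by (simp add: algebra_simps)
  next
    fix z :: complex and e :: real
    assume z: "z \<noteq> 0" and e: "0 < e" "e < 1"
      and rad: "outer_f (of_real e * z * of_real (vr / v)) (of_real e * z) (e\<^sup>2) r
          (sj (of_real e * z * of_real (r 3))) (z * z * of_real (r 3 ^ 3) * chi (of_real e * z * of_real (r 3)))
        = (\<i> * (of_real e * z * of_real (vr / v)) * (of_real (r 1))\<^sup>2 - of_real (r 1))
          * outer_u (of_real e * z * of_real (vr / v)) (of_real e * z) (e\<^sup>2) r
          (sj (of_real e * z * of_real (r 3))) (z * z * of_real (r 3 ^ 3) * chi (of_real e * z * of_real (r 3)))"
    define w where "w = of_real vr * (of_real e * z)"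
    have k: "w / of_real v = of_real e * z * of_real (vr / v)" "w / of_real vr = of_real e * z"
      using hvr by (simp_all add: w_def)
    have nz: "w \<noteq> 0" "e\<^sup>2 \<noteq> 0" using z e hvr by (auto simp: w_def)
    show "det (transA 3 r v vr w (e\<^sup>2)) = 0"
      by (rule det_transA_3[OF hv hvr nz r'(1-3), unfolded k, OF refl _ rad])
        (simp add: power2_eq_square mult_ac)
  qed
next
  assume r: "r 1 > r 2 \<and> r 2 > r 3 \<and> r 3 > r 4 \<and> r 4 > 0"
  define E where "E = r 3 ^ 3 - r 4 ^ 3"
  have r': "0 < r 3" "r 3 < r 2" "r 2 < r 1" "0 < E" and r4: "0 < r 4" "r 4 < r 3"
    using r by (auto simp: E_def power_strict_mono)
  have E': "x + r 3 ^ 3 - r 4 ^ 3 = x + E" for x by (simp add: E_def)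
  define u4 where "u4 z e = sj (of_real e * z * (of_real (vr / v) * of_real (r 4)))" for z e
  \<comment> \<open>The core consists of background material, so its flux is not divided by \<delta>
    and keeps the factor e^2 of k^2. It vanishes in the limit, and only the shell volume r_3^3 -
    r_4^3 survives.\<close>
  define f4 where "f4 z e = (of_real e)\<^sup>2 * (z * z * of_real ((vr / v)\<^sup>2 * r 4 ^ 3)
      * chi (of_real e * z * (of_real (vr / v) * of_real (r 4))))" for z e
  have u4: "expands u4 (\<lambda>z. 1)" unfolding u4_def by (rule expands_trig)
  have "expands f4 (\<lambda>z. 0 * (z * z * of_real ((vr / v)\<^sup>2 * r 4 ^ 3) * (- 1 / 3)))"
    unfolding f4_def by (intro expands_mult expands_eps2 expands_var expands_const expands_trig)
  then have f4: "expands f4 (\<lambda>z. 0)" by simp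
  define u where "u z e = transfer_field (of_real e * z) (r 4) (r 3) (u4 z e) ((of_real e)\<^sup>2 * f4 z e)" for z e
  define f where "f z e = transfer_flux (of_real e * z) (r 4) (r 3) (u4 z e) ((of_real e)\<^sup>2 * f4 z e)
      / (of_real e)\<^sup>2" for z e
  note shell = expands_transfer_resonator[OF r4 u4 f4]
  show "let \<tau> = v / vr;
          \<Xi> = r 2 * r 3 * (r 1 ^ 3 - r 2 ^ 3 + r 3 ^ 3 - r 4 ^ 3) + r 1 * (r 2 - r 3) * (r 3 ^ 3 - r 4 ^ 3);
          P = (r 1 ^ 3 - r 2 ^ 3) * (r 3 ^ 3 - r 4 ^ 3) * (r 2 - r 3);
          \<Delta> = \<Xi> ^ 2 - 4 * r 1 * r 2 * r 3 * P;
          a1 = vr * sqrt ((3 * \<Xi> - 3 * sqrt \<Delta>) / (2 * P));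
          b1 = (3 * (- \<Xi> + sqrt \<Delta>) + 6 * r 2 * r 3 * (r 1 ^ 3 - r 2 ^ 3))
                 / (4 * \<tau> * (r 1 ^ 3 - r 2 ^ 3) * sqrt \<Delta>) * vr * r 1 ^ 2;
          a2 = vr * sqrt ((3 * \<Xi> + 3 * sqrt \<Delta>) / (2 * P));
          b2 = (3 * (\<Xi> + sqrt \<Delta>) - 6 * r 2 * r 3 * (r 1 ^ 3 - r 2 ^ 3))
                 / (4 * \<tau> * (r 1 ^ 3 - r 2 ^ 3) * sqrt \<Delta>) * vr * r 1 ^ 2
      in \<Delta> > 0 \<and>
         (\<exists>\<delta>0 > 0. \<exists>\<omega>1 \<omega>2 :: real \<Rightarrow> complex.
            continuous_on {0<..<\<delta>0} \<omega>1 \<and> continuous_on {0<..<\<delta>0} \<omega>2 \<and>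
            (\<forall>\<delta> \<in> {0<..<\<delta>0}.
               det (transA 4 r v vr (\<omega>1 \<delta>) \<delta>) = 0 \<and> Re (\<omega>1 \<delta>) > 0 \<and>
               det (transA 4 r v vr (\<omega>2 \<delta>) \<delta>) = 0 \<and> Re (\<omega>2 \<delta>) > 0) \<and>
            (\<lambda>\<delta>. \<omega>1 \<delta> - (complex_of_real (a1 * sqrt \<delta>) - \<i> * complex_of_real (b1 * \<delta>)))
               \<in> O[at_right 0](\<lambda>\<delta>. complex_of_real (\<delta> powr (3/2))) \<and>
            (\<lambda>\<delta>. \<omega>2 \<delta> - (complex_of_real (a2 * sqrt \<delta>) - \<i> * complex_of_real (b2 * \<delta>)))
               \<in> O[at_right 0](\<lambda>\<delta>. complex_of_real (\<delta> powr (3/2))))"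
    unfolding Let_def E' E_def[symmetric]
  proof (intro conjI discriminant_bounds(3)[OF r']
      layer_resonances[where r = r and zero = "\<lambda>w d. det (transA 4 r v vr w d) = 0" and u = u and f = f, OF hv hvr r'])
    show "expands u (\<lambda>z. 1)" unfolding u_def by (rule shell(1))
    show "expands f (\<lambda>z. - (z\<^sup>2 * of_real (E / 3)))"
      unfolding f_def by (rule expands_cong[OF shell(2)]) (simp_all add: E_def)
  next
    fix z :: complex and e :: real
    assume z: "z \<noteq> 0" and e: "0 < e" "e < 1"
      and rad: "outer_f (of_real e * z * of_real (vr / v)) (of_real e * z) (e\<^sup>2) r (u z e) (f z e)
        = (\<i> * (of_real e * z * of_real (vr / v)) * (of_real (r 1))\<^sup>2 - of_real (r 1))
          * outer_u (of_real e * z * of_real (vr / v)) (of_real e * z) (e\<^sup>2) r (u z e) (f z e)"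
    define w where "w = of_real vr * (of_real e * z)"
    have k: "w / of_real v = of_real e * z * of_real (vr / v)" "w / of_real vr = of_real e * z"
      using hvr by (simp_all add: w_def)
    have nz: "w \<noteq> 0" "e\<^sup>2 \<noteq> 0" using z e hvr by (auto simp: w_def)
    show "det (transA 4 r v vr w (e\<^sup>2)) = 0"
    proof (rule det_transA_4[OF hv hvr nz r4 r'(2,3), unfolded k, OF _ _ _ _ rad])
      show "u4 z e = sj (of_real e * z * of_real (vr / v) * of_real (r 4))"
        by (simp add: u4_def mult.assoc)
      show "f4 z e = (of_real e * z * of_real (vr / v))\<^sup>2 * of_real (r 4 ^ 3)
          * chi (of_real e * z * of_real (vr / v) * of_real (r 4))"
        by (simp add: f4_def power_mult_distrib power2_eq_square mult.assoc mult.left_commute)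
      show "u z e = transfer_field (of_real e * z) (r 4) (r 3) (u4 z e) (of_real (e\<^sup>2) * f4 z e)"
        by (simp add: u_def)
      show "of_real (e\<^sup>2) * f z e = transfer_flux (of_real e * z) (r 4) (r 3) (u4 z e) (of_real (e\<^sup>2) * f4 z e)"
        using e by (simp add: f_def)
    qed
  qed (simp_all only: mult.assoc mult.commute[of vr "r 1 ^ 2"])
qed

end
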